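(* Let $f$ be a real-valued locally integrable function on $[0,\infty)$ which is continuously differentiable on $(0,\infty)$. Suppose that $f$ has an analytic continuation (still denoted $f$) in the first quadrant of the complex plane, except possibly a branch point of algebraic type at the origin, and that there exist constants $M>0$, $\delta<1$ and $d\ge0$ such that $$|f(z)|\le M|z|^{\delta}e^{d\,\mathrm{Im}(z)}$$ as $|z|\to\infty$ in the first quadrant (with $\omega>d$ below). Assume moreover that $f$ has an asymptotic expansion of the form $$f(t)\sim\sum_{j=0}^\infty a_j t^{j-\alpha},\qquad t\to0^+,$$ where $0\le\alpha<1$. Then, for each $x>0$, $$H^+(f(t)e^{i\omega t})(x)\sim i\pi e^{i\omega x}f(x)-\sum_{\ell=0}^\infty\frac{\Gamma(\ell+1-\alpha)}{\omega^{\ell+1-\alpha}}\,e^{\frac{\pi}{2}(\ell+1-\alpha)i}\left(\sum_{j+k=\ell}\frac{a_j}{x^{k+1}}\right)$$ as $\omega\to\infty$.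
   Context: For $x>0$ and $\omega>0$, the one-sided oscillatory Hilbert transform is the Cauchy principal value $$H^+(f(t)e^{i\omega t})(x)=\lim_{\varepsilon\to0^+}\left(\int_0^{x-\varepsilon}+\int_{x+\varepsilon}^\infty\right)e^{i\omega t}\frac{f(t)}{t-x}\,dt,$$ the integral at infinity being an improper integral (assumed to exist). "First quadrant" means the closed quadrant $\{\mathrm{Re}\,z\ge0,\ \mathrm{Im}\,z\ge0\}$ with the origin removed. "Branch point of algebraic type at the origin" means that near $0$ in this quadrant $f(z)=z^{-\beta}h(z)$ for some real $\beta$, with the principal branch of the power and $h$ analytic near $0$. The growth condition is required for all $z$ in the quadrant with $|z|$ sufficiently large. The symbol $\sim$ denotes a Poincaré asymptotic expansion: $f(t)=\sum_{j=0}^{N-1}a_jt^{j-\alpha}+O(t^{N-\alpha})$ as $t\to0^+$ for every $N$, and for fixed $x$ the conclusion means that for every $N$ the difference between $H^+(f(t)e^{i\omega t})(x)$ and $i\pi e^{i\omega x}f(x)-\sum_{\ell=0}^{N-1}(\cdots)$ is $O(\omega^{-(N+1-\alpha)})$ as $\omega\to\infty$. The inner sum is over integers $j,k\ge0$ with $j+k=\ell$. *)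

theory Defs
  imports "HOL-Complex_Analysis.Complex_Analysis" "HOL-Library.Landau_Symbols"
begin

definition first_quadrant :: "complex set" where
  "first_quadrant = {z. Re z \<ge> 0 \<and> Im z \<ge> 0 \<and> z \<noteq> 0}"

text \<open>
  On \<open>first_quadrant\<close> the principal branch is unambiguous, since \<open>Arg z\<close> lies in \<open>[0, pi/2]\<close>.
  The case \<open>\<beta> = 0\<close> covers functions that are regular at the origin.
\<close>

definition algebraic_at_origin :: "(complex \<Rightarrow> complex) \<Rightarrow> bool" where
  "algebraic_at_origin F \<longleftrightarrow>
     (\<exists>\<beta>::real. \<exists>h. h analytic_on {0} \<and>
        (\<exists>r>0. \<forall>z\<in>first_quadrant. norm z < r \<longrightarrow> F z = z powr (- of_real \<beta>) * h z))"

definition has_improper_integral :: "(real \<Rightarrow> complex) \<Rightarrow> real \<Rightarrow> complex \<Rightarrow> bool" where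
  "has_improper_integral g a I \<longleftrightarrow>
     (\<forall>R\<ge>a. g integrable_on {a..R}) \<and> ((\<lambda>R. integral {a..R} g) \<longlongrightarrow> I) at_top"

definition osc_kernel :: "(real \<Rightarrow> real) \<Rightarrow> real \<Rightarrow> real \<Rightarrow> real \<Rightarrow> complex" where
  "osc_kernel f \<omega> x t = exp (\<i> * of_real (\<omega> * t)) * of_real (f t / (t - x))"

text \<open>
  Principal value at \<open>x\<close>, with the tail an improper (possibly only conditionally convergent)
  integral \<open>J \<epsilon>\<close>.
\<close>

definition has_osc_hilbert :: "(real \<Rightarrow> real) \<Rightarrow> real \<Rightarrow> real \<Rightarrow> complex \<Rightarrow> bool" where
  "has_osc_hilbert f \<omega> x L \<longleftrightarrow>
     (\<exists>J. (\<forall>\<epsilon>. 0 < \<epsilon> \<and> \<epsilon> < x \<longrightarrow>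
              osc_kernel f \<omega> x integrable_on {0..x - \<epsilon>} \<and>
              has_improper_integral (osc_kernel f \<omega> x) (x + \<epsilon>) (J \<epsilon>)) \<and>
          ((\<lambda>\<epsilon>. integral {0..x - \<epsilon>} (osc_kernel f \<omega> x) + J \<epsilon>) \<longlongrightarrow> L) (at_right 0))"

text \<open>Only meaningful where some \<open>L\<close> exists; it is then unique.\<close>

definition osc_hilbert :: "(real \<Rightarrow> real) \<Rightarrow> real \<Rightarrow> real \<Rightarrow> complex" where
  "osc_hilbert f \<omega> x = (THE L. has_osc_hilbert f \<omega> x L)"

end

theory Submission
  imports Defs "HOL-Real_Asymp.Real_Asymp"
begin

text \<open>
  The principal value integral is moved from the positive real axis to the positive imaginary axis, where
  \<open>exp (\<i> \<omega> z)\<close> decays and Watson's lemma applies.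

  Let \<open>K z = exp (\<i> \<omega> z) * F z / (z - x)\<close>. The closed quadrant without the origin is convex, so up
  to the pole at \<open>x\<close>, which a logarithm takes care of, \<open>K\<close> has a primitive \<open>W\<close> there
  (\<open>cauchy_kernel_primitive\<close>). Along the segment from \<open>\<tau>\<close> to \<open>\<i> \<tau>\<close> the increment of \<open>W\<close> tends to zero as
  \<open>\<tau> \<rightarrow> 0\<close>, because \<open>F z\<close> is at most of order \<open>z powr (- \<alpha>)\<close> with \<open>\<alpha> < 1\<close>, and as \<open>\<tau> \<rightarrow> \<infinity>\<close>,
  by the growth condition with \<open>\<delta> < 1\<close> and \<open>\<omega> > d\<close> (\<open>primitive_chord_origin\<close>,
  \<open>primitive_chord_infinity\<close>). Therefore the two axes carry the same integral up to the
  jump of \<open>W\<close> across \<open>x\<close>, and the Hilbert transform exists and equals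
  \<open>\<i> \<pi> exp (\<i> \<omega> x) f x + V \<omega>\<close> with
  \<open>V \<omega> = \<integral> \<i> * exp (- \<omega> y) * F (\<i> y) / (\<i> y - x) dy\<close> over \<open>y > 0\<close>
  (\<open>has_osc_hilbert_rotated\<close>).

  It remains to expand \<open>V\<close>. The expansion of \<open>f\<close> at the origin is assumed only along the real axis. Since \<open>F\<close> is a
  power times an analytic function, it persists on the whole quadrant (\<open>quadrant_expansion\<close>),
  and multiplication by the geometric series of \<open>1 / (z - x)\<close> turns the coefficients \<open>a j\<close> into the convolution
  sums of the theorem (\<open>quadrant_kernel_expansion\<close>). Each term integrates to a Gamma value with
  the phase of a power of \<open>\<i>\<close>, and the remainder is bounded on the whole half-line by
  a multiple of \<open>y powr (N - \<alpha>) * exp (D y)\<close>, whose Laplace transform is of the required order in \<open>\<omega>\<close>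
  (\<open>rotated_integral_expansion\<close>).
\<close>

section \<open>Expansion at the origin of the quadrant\<close>

lemma powr_bigo_at_right_0_iff:
  "(\<lambda>t::real. t powr p) \<in> O[at_right 0](\<lambda>t. t powr q) \<longleftrightarrow> q \<le> p"
proof -
  have "(\<lambda>t::real. inverse t powr (-p)) \<in> O[at_right 0](\<lambda>t. inverse t powr (-q)) \<longleftrightarrow> -p \<le> -q"
    by (rule powr_bigo_iff) (auto intro: filterlim_inverse_at_top_right)
  moreover have ev: "eventually (\<lambda>t::real. inverse t powr (-p) = t powr p) (at_right 0)" for p
    using eventually_at_right_less[of "0::real"]
    by eventually_elim (simp add: powr_minus inverse_powr)
  ultimately show ?thesis
    using landau_o.big.cong_ex[OF ev[of p] ev[of q]] by simp
qed

lemma filterlim_of_real_quadrant: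
  "filterlim complex_of_real (at 0 within first_quadrant) (at_right 0)"
  unfolding filterlim_at
  using eventually_at_right_less[of "0::real"]
  by (auto simp: first_quadrant_def tendsto_of_real_iff intro!: tendsto_eq_intros elim!: eventually_mono)

lemma filterlim_of_real_nhds_0: "filterlim complex_of_real (nhds 0) (at_right 0)"
  by (rule tendsto_eq_intros | simp)+

lemma power_theta_powr_at_right_0:
  "(\<lambda>t. complex_of_real t ^ m) \<in> \<Theta>[at_right 0](\<lambda>t. complex_of_real (t powr real m))"
proof (rule bigthetaI_cong)
  show "\<forall>\<^sub>F t in at_right 0. complex_of_real t ^ m = complex_of_real (t powr real m)"
    using eventually_at_right_less[of "0::real"]
    by eventually_elim (simp add: powr_realpow)
qed

text \<open>
  The alternative is whether the Taylor series at the origin vanishes; if it does not, its first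
  nonzero term dominates.
\<close>
lemma analytic_zero_or_power:
  fixes h :: "complex \<Rightarrow> complex"
  assumes "h analytic_on {0}"
  shows "eventually (\<lambda>z. h z = 0) (nhds 0) \<or> (\<exists>m. h \<in> \<Theta>[nhds 0](\<lambda>z. z ^ m))"
proof -
  define H where "H = fps_expansion h 0"
  have H: "h has_fps_expansion H"
    unfolding H_def using assms by (rule analytic_at_imp_has_fps_expansion_0)
  show ?thesis
  proof (cases "H = 0")
    case True
    then show ?thesis using H by (simp add: has_fps_expansion_0_iff)
  next
    case False
    have "h \<in> \<Theta>[nhds 0](\<lambda>z. fps_nth H (subdegree H) * z ^ subdegree H)"
      by (intro asymp_equiv_imp_bigtheta has_fps_expansion_imp_asymp_equiv_0 H)
    also have "fps_nth H (subdegree H) \<noteq> 0"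
      using False by simp
    hence "(\<lambda>z. fps_nth H (subdegree H) * z ^ subdegree H) \<in> \<Theta>[nhds 0](\<lambda>z. z ^ subdegree H)"
      by simp
    finally show ?thesis by blast
  qed
qed

text \<open>
  An analytic function is near the origin either zero or comparable to a pure power, so its order
  of vanishing can be read off along a single ray. This is how the expansion of \<open>f\<close>, which is
  known only on the positive axis, gives information on the imaginary axis.
\<close>
lemma analytic_bigo_from_ray:
  fixes h :: "complex \<Rightarrow> complex"
  assumes "h analytic_on {0}"
    and ray: "(\<lambda>t. h (of_real t)) \<in> O[at_right 0](\<lambda>t. complex_of_real (t powr real n))"
  shows "h \<in> O[nhds 0](\<lambda>z. z ^ n)"
  using analytic_zero_or_power[OF assms(1)]
proof (elim disjE exE)
  assume "\<forall>\<^sub>F z in nhds 0. h z = 0"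
  thus ?thesis
    by (intro bigoI[where c=0]) (auto elim: eventually_mono)
next
  fix m assume m: "h \<in> \<Theta>[nhds 0](\<lambda>z. z ^ m)"
  have "(\<lambda>t. complex_of_real (t powr real m)) \<in> O[at_right 0](\<lambda>t. of_real t ^ m)"
    using bigthetaD2[OF power_theta_powr_at_right_0] by (simp only: bigomega_iff_bigo)
  also have "(\<lambda>t. of_real t ^ m) \<in> O[at_right 0](\<lambda>t. h (of_real t))"
    using landau_theta.compose[OF m filterlim_of_real_nhds_0]
    by (simp add: bigtheta_def bigomega_iff_bigo)
  also note ray
  finally have "(\<lambda>t. t powr real m) \<in> O[at_right 0](\<lambda>t. t powr real n)"
    by (rule landau_o.big.of_real_cancel)
  hence "n \<le> m" by (simp add: powr_bigo_at_right_0_iff)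
  have "(\<lambda>z::complex. z ^ m) \<in> O[nhds 0](\<lambda>z. z ^ n)"
  proof (rule bigoI[where c=1])
    have "\<forall>\<^sub>F z in nhds 0. norm (z::complex) < 1"
      by (rule order_tendstoD(2)[OF tendsto_norm_zero]) (auto simp: filterlim_ident)
    thus "\<forall>\<^sub>F z in nhds 0. norm (z ^ m) \<le> 1 * norm ((z::complex) ^ n)"
      by eventually_elim (use \<open>n \<le> m\<close> in \<open>auto simp: norm_power intro!: power_decreasing\<close>)
  qed
  with m show ?thesis
    using landau_o.big_trans bigthetaD1 by blast
qed

text \<open>
  Near the origin \<open>F z = z powr (- \<beta>) * h z\<close> with an exponent \<open>\<beta>\<close> that need not be \<open>\<alpha>\<close>. If \<open>h\<close>
  vanishes to order \<open>m\<close> and \<open>a p\<close> is the first nonzero coefficient, then \<open>f t\<close> is comparable both to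
  \<open>t powr (m - \<beta>)\<close> and to \<open>t powr (p - \<alpha>)\<close>, so these exponents agree and \<open>\<beta> - \<alpha>\<close> is an
  integer. If \<open>h\<close> vanishes identically near the origin, so does \<open>F\<close>, and any exponents serve.
  The factors \<open>z ^ m\<close> and \<open>z ^ p\<close> are kept on their sides so that
  no quotient of analytic functions has to be continued to the origin.
\<close>
lemma algebraic_exponent_matches:
  fixes f :: "real \<Rightarrow> real" and a :: "nat \<Rightarrow> real" and \<alpha> :: real
  assumes alg: "algebraic_at_origin F"
    and Ff: "\<And>t. t > 0 \<Longrightarrow> F (of_real t) = of_real (f t)"
    and expansion: "\<And>N. (\<lambda>t. f t - (\<Sum>j<N. a j * t powr (real j - \<alpha>)))
                 \<in> O[at_right 0](\<lambda>t. t powr (real N - \<alpha>))"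
  obtains m p h where "h analytic_on {0}"
    "\<forall>\<^sub>F z in at 0 within first_quadrant. z ^ m * F z = z powr (- of_real \<alpha>) * z ^ p * h z"
proof -
  obtain \<beta> h r where h: "h analytic_on {0}" and "r > 0"
    and F: "\<And>z. z \<in> first_quadrant \<Longrightarrow> norm z < r \<Longrightarrow> F z = z powr (- of_real \<beta>) * h z"
    using alg unfolding algebraic_at_origin_def by blast
  have evF: "\<forall>\<^sub>F z in at 0 within first_quadrant. F z = z powr (- of_real \<beta>) * h z"
    using \<open>r > 0\<close> F by (auto simp: eventually_at dist_norm)
  have ev0: "\<forall>\<^sub>F z in at 0 within first_quadrant. z \<noteq> 0"
    by (auto simp: eventually_at first_quadrant_def intro: exI[of _ 1])
  have evh: "\<forall>\<^sub>F t in at_right 0. of_real (f t) = of_real (t powr (-\<beta>)) * h (of_real t)"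
    using filterlim_of_real_quadrant[unfolded filterlim_iff, rule_format, OF evF] eventually_at_right_less[of "0::real"]
  proof eventually_elim
    case (elim t)
    thus ?case using powr_of_real[of t "-\<beta>"] Ff[of t] by simp
  qed
  show ?thesis
    using analytic_zero_or_power[OF h]
  proof (elim disjE exE)
    assume "\<forall>\<^sub>F z in nhds 0. h z = 0"
    hence "\<forall>\<^sub>F z in at 0 within first_quadrant. h z = 0"
      by (rule filter_leD[OF at_within_le_nhds])
    with evF have "\<forall>\<^sub>F z in at 0 within first_quadrant. z ^ 0 * F z = z powr (- of_real \<alpha>) * z ^ 0 * 0"
      by eventually_elim simp
    thus ?thesis by (rule that[of "\<lambda>_. 0", rotated]) auto
  next
    fix m assume m: "h \<in> \<Theta>[nhds 0](\<lambda>z. z ^ m)"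
    have "(\<lambda>t. h (of_real t)) \<in> \<Theta>[at_right 0](\<lambda>t. of_real t ^ m)"
      by (rule landau_theta.compose[OF m filterlim_of_real_nhds_0])
    also have "(\<lambda>t. complex_of_real t ^ m) \<in> \<Theta>[at_right 0](\<lambda>t. complex_of_real (t powr real m))"
      by (rule power_theta_powr_at_right_0)
    finally have "(\<lambda>t. of_real (t powr (-\<beta>)) * h (of_real t)) \<in>
        \<Theta>[at_right 0](\<lambda>t. of_real (t powr (-\<beta>)) * complex_of_real (t powr real m))"
      by (intro landau_theta.mult) auto
    also have "(\<lambda>t. of_real (t powr (-\<beta>)) * complex_of_real (t powr real m)) =
               (\<lambda>t. complex_of_real (t powr (real m - \<beta>)))"
      by (simp add: powr_add [symmetric] flip: of_real_mult)
    also have "(\<lambda>t. of_real (t powr (-\<beta>)) * h (of_real t)) \<in>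
        \<Theta>[at_right 0](\<lambda>t. complex_of_real (t powr (real m - \<beta>))) \<longleftrightarrow>
        (\<lambda>t. complex_of_real (f t)) \<in> \<Theta>[at_right 0](\<lambda>t. complex_of_real (t powr (real m - \<beta>)))"
      by (rule landau_theta.in_cong) (use evh in eventually_elim, simp)
    finally have f1: "f \<in> \<Theta>[at_right 0](\<lambda>t. t powr (real m - \<beta>))"
      by (rule landau_theta.of_real_cancel)
    show ?thesis
    proof (cases "\<exists>j. a j \<noteq> 0")
      case False
      \<comment> \<open>all \<open>a j\<close> vanish, so \<open>f\<close> decays faster than the power that \<open>h\<close> forces on it\<close>
      obtain N :: nat where N: "real N > real m - \<beta> + \<alpha>"
        using reals_Archimedean2 by blast
      have "(\<lambda>t. t powr (real m - \<beta>)) \<in> O[at_right 0](f)"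
        using bigthetaD2[OF f1] by (simp only: bigomega_iff_bigo)
      also have "f \<in> O[at_right 0](\<lambda>t. t powr (real N - \<alpha>))"
        using expansion[of N] False by simp
      finally show ?thesis
        using N by (simp add: powr_bigo_at_right_0_iff)
    next
      case True
      define p where "p = (LEAST j. a j \<noteq> 0)"
      have ap: "a p \<noteq> 0"
        unfolding p_def using True by (rule LeastI_ex)
      have a0: "a j = 0" if "j < p" for j
        using not_less_Least that unfolding p_def by blast
      have "(\<lambda>t. f t - a p * t powr (real p - \<alpha>)) \<in> O[at_right 0](\<lambda>t. t powr (real (Suc p) - \<alpha>))"
        using expansion[of "Suc p"] a0 by simp
      also have "(\<lambda>t. t powr (real (Suc p) - \<alpha>)) \<in> o[at_right 0](\<lambda>t. a p * t powr (real p - \<alpha>))"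
      proof -
        have "((\<lambda>t::real. t) \<longlongrightarrow> 0) (at_right 0)"
          by (rule tendsto_eq_intros refl)+
        moreover have "\<forall>\<^sub>F t in at_right 0. t powr (real (Suc p) - \<alpha>) / t powr (real p - \<alpha>) = t"
          using eventually_at_right_less[of "0::real"]
          by eventually_elim (simp flip: powr_diff)
        ultimately have "((\<lambda>t. t powr (real (Suc p) - \<alpha>) / t powr (real p - \<alpha>)) \<longlongrightarrow> 0) (at_right 0)"
          by (simp add: tendsto_cong)
        hence "(\<lambda>t. t powr (real (Suc p) - \<alpha>)) \<in> o[at_right 0](\<lambda>t. t powr (real p - \<alpha>))"
          by (rule smalloI_tendsto) (use eventually_at_right_less[of "0::real"] in \<open>auto elim: eventually_mono\<close>)
        thus ?thesis using ap by simp
      qed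
      finally have "f \<in> \<Theta>[at_right 0](\<lambda>t. a p * t powr (real p - \<alpha>))"
        by (intro asymp_equiv_imp_bigtheta smallo_imp_asymp_equiv)
      hence f2: "f \<in> \<Theta>[at_right 0](\<lambda>t. t powr (real p - \<alpha>))"
        using ap by simp
      have "(\<lambda>t. t powr (real m - \<beta>)) \<in> \<Theta>[at_right 0](f)"
        using f1 by (rule bigtheta_sym[THEN iffD1])
      also note f2
      finally have eq: "real m - \<beta> = real p - \<alpha>"
        using powr_bigo_at_right_0_iff by (auto simp: bigtheta_def bigomega_iff_bigo intro: antisym)
      have eq': "of_nat m - complex_of_real \<beta> = of_nat p - complex_of_real \<alpha>"
        using arg_cong[OF eq, of complex_of_real] by simp
      have "\<forall>\<^sub>F z in at 0 within first_quadrant. z ^ m * F z = z powr (- of_real \<alpha>) * z ^ p * h z"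
        using evF ev0
      proof eventually_elim
        case (elim z)
        have "z ^ m * F z = z powr (of_nat m - of_real \<beta>) * h z"
          using elim by (simp add: powr_diff powr_minus field_simps)
        also note eq'
        also have "z powr (of_nat p - of_real \<alpha>) * h z = z powr (- of_real \<alpha>) * z ^ p * h z"
          using elim by (simp add: powr_diff powr_minus field_simps)
        finally show ?case .
      qed
      thus ?thesis by (rule that[OF h])
    qed
  qed
qed

text \<open>
  Multiplied by \<open>z powr (m + \<alpha>)\<close>, the remainder of the expansion becomes a function that is analytic
  at the origin, so its size on the positive axis determines its size in the quadrant.
\<close>
lemma quadrant_expansion:
  fixes f :: "real \<Rightarrow> real" and a :: "nat \<Rightarrow> real" and \<alpha> :: real
  assumes alg: "algebraic_at_origin F"
    and Ff: "\<And>t. t > 0 \<Longrightarrow> F (of_real t) = of_real (f t)"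
    and expansion: "\<And>N. (\<lambda>t. f t - (\<Sum>j<N. a j * t powr (real j - \<alpha>)))
                 \<in> O[at_right 0](\<lambda>t. t powr (real N - \<alpha>))"
  shows "(\<lambda>z. F z - (\<Sum>j<N. of_real (a j) * z powr of_real (real j - \<alpha>)))
           \<in> O[at 0 within first_quadrant](\<lambda>z. z powr of_real (real N - \<alpha>))"
proof -
  obtain m p h where h: "h analytic_on {0}" and
    ev: "\<forall>\<^sub>F z in at 0 within first_quadrant. z ^ m * F z = z powr (- of_real \<alpha>) * z ^ p * h z"
    using algebraic_exponent_matches[OF assms] by blast
  have ev0: "\<forall>\<^sub>F z in at 0 within first_quadrant. z \<noteq> 0"
    by (auto simp: eventually_at first_quadrant_def intro: exI[of _ 1])
  define u where "u = (\<lambda>z. z ^ p * h z - z ^ m * (\<Sum>j<N. of_real (a j) * z ^ j))"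
  have u: "u analytic_on {0}"
    unfolding u_def by (intro analytic_intros h)
  have evu: "\<forall>\<^sub>F z in at 0 within first_quadrant.
      F z - (\<Sum>j<N. of_real (a j) * z powr of_real (real j - \<alpha>)) = u z * z powr (- of_real (real m + \<alpha>))"
    using ev ev0
  proof eventually_elim
    case (elim z)
    have "(\<Sum>j<N. of_real (a j) * z powr of_real (real j - \<alpha>)) =
          z powr (- of_real \<alpha>) * (\<Sum>j<N. of_real (a j) * z ^ j)"
      using elim by (simp add: powr_diff powr_minus field_simps sum_distrib_left)
    moreover have "F z = z powr (- of_real \<alpha>) * z ^ p * h z / z ^ m"
      using elim by (simp add: field_simps)
    moreover have "z powr (- of_real (real m + \<alpha>)) = z powr (- of_real \<alpha>) / z ^ m"
      using elim by (simp add: powr_diff powr_minus field_simps)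
    ultimately show ?case
      using elim by (simp only: u_def) (simp add: field_simps)
  qed
  have "(\<lambda>t. of_real (t powr (real m + \<alpha>)) * complex_of_real (f t - (\<Sum>j<N. a j * t powr (real j - \<alpha>))))
          \<in> O[at_right 0](\<lambda>t. of_real (t powr (real m + \<alpha>)) * complex_of_real (t powr (real N - \<alpha>)))"
    by (intro landau_o.big.mult landau_o.big.of_real_iff[THEN iffD2] expansion) simp
  also have "(\<lambda>t. of_real (t powr (real m + \<alpha>)) * complex_of_real (t powr (real N - \<alpha>))) =
             (\<lambda>t. complex_of_real (t powr real (m + N)))"
    by (simp add: powr_add [symmetric] flip: of_real_mult)
  also have "(\<lambda>t. of_real (t powr (real m + \<alpha>)) * complex_of_real (f t - (\<Sum>j<N. a j * t powr (real j - \<alpha>))))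
          \<in> O[at_right 0](\<lambda>t. complex_of_real (t powr real (m + N))) \<longleftrightarrow>
     (\<lambda>t. u (of_real t)) \<in> O[at_right 0](\<lambda>t. complex_of_real (t powr real (m + N)))"
  proof (rule landau_o.big.in_cong)
    show "\<forall>\<^sub>F t in at_right 0. of_real (t powr (real m + \<alpha>)) *
        complex_of_real (f t - (\<Sum>j<N. a j * t powr (real j - \<alpha>))) = u (of_real t)"
      using filterlim_of_real_quadrant[unfolded filterlim_iff, rule_format, OF evu]
        eventually_at_right_less[of "0::real"]
    proof eventually_elim
      case (elim t)
      have "complex_of_real (f t - (\<Sum>j<N. a j * t powr (real j - \<alpha>))) = u (of_real t) * of_real (t powr (- (real m + \<alpha>)))"
      proof -
        have "complex_of_real t powr of_real (real j - \<alpha>) = of_real (t powr (real j - \<alpha>))" for j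
          using elim(2) by (intro powr_of_real) auto
        moreover have "complex_of_real t powr (- of_real (real m + \<alpha>)) = of_real (t powr (- (real m + \<alpha>)))"
          using elim(2) powr_of_real[of t "- (real m + \<alpha>)"] by simp
        ultimately show ?thesis
          using elim(1,2) Ff[of t] by simp
      qed
      moreover have "t powr (real m + \<alpha>) * t powr (- (real m + \<alpha>)) = 1"
        using elim(2) by (simp only: powr_add [symmetric]) simp
      ultimately show ?case
        by (simp only: mult.commute[of "u _"] mult.assoc [symmetric] flip: of_real_mult) simp
    qed
  qed
  finally have "u \<in> O[nhds 0](\<lambda>z. z ^ (m + N))"
    by (rule analytic_bigo_from_ray[OF u])
  hence "u \<in> O[at 0 within first_quadrant](\<lambda>z. z ^ (m + N))"
    by (rule landau_o.big.filter_mono[OF at_within_le_nhds])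
  hence "(\<lambda>z. u z * z powr (- of_real (real m + \<alpha>)))
      \<in> O[at 0 within first_quadrant](\<lambda>z. z ^ (m + N) * z powr (- of_real (real m + \<alpha>)))"
    by (intro landau_o.big.mult) auto
  thus ?thesis
  proof (rule iffD1[OF landau_o.big.cong_ex, rotated 2])
    show "\<forall>\<^sub>F z in at 0 within first_quadrant.
        u z * z powr (- of_real (real m + \<alpha>)) = F z - (\<Sum>j<N. of_real (a j) * z powr of_real (real j - \<alpha>))"
      using evu by eventually_elim simp
    show "\<forall>\<^sub>F z in at 0 within first_quadrant.
        z ^ (m + N) * z powr (- of_real (real m + \<alpha>)) = z powr of_real (real N - \<alpha>)"
      using ev0 by eventually_elim (simp add: powr_diff powr_minus powr_add power_add field_simps)
  qed
qed

section \<open>Expansion of the Cauchy quotient\<close>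

text \<open>
  Since \<open>1 / (x - z)\<close> is the geometric series \<open>\<Sum>k. z ^ k / x ^ (k + 1)\<close>, these are the coefficients of
  \<open>z powr (l - \<alpha>)\<close> in the expansion of \<open>F z / (x - z)\<close>.
\<close>
definition kernel_coeff :: "(nat \<Rightarrow> real) \<Rightarrow> real \<Rightarrow> nat \<Rightarrow> real" where
  "kernel_coeff a x l = (\<Sum>(j, k)\<in>{(j, k). j + k = l}. a j / x ^ (k + 1))"

lemma kernel_coeff_altdef: "kernel_coeff a x l = (\<Sum>j\<le>l. a j / x ^ (l - j + 1))"
  unfolding kernel_coeff_def
  by (rule sum.reindex_bij_witness[of _ "\<lambda>j. (j, l - j)" fst]) auto

lemma kernel_coeff_Suc:
  assumes "x \<noteq> 0"
  shows "x * kernel_coeff a x (Suc l) = a (Suc l) + kernel_coeff a x l"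
proof -
  have "x * (\<Sum>j\<le>l. a j / x ^ (Suc l - j + 1)) = (\<Sum>j\<le>l. a j / x ^ (l - j + 1))"
    unfolding sum_distrib_left using assms
    by (intro sum.cong refl) (auto simp: Suc_diff_le field_simps)
  thus ?thesis using assms
    by (simp add: kernel_coeff_altdef algebra_simps)
qed

text \<open>
  Multiplying the truncated product series by \<open>x - z\<close> telescopes to the truncated series of \<open>a\<close> and one
  boundary term. Its coefficient \<open>x * kernel_coeff a x N - a N\<close> is \<open>kernel_coeff a x (N - 1)\<close> for
  \<open>N > 0\<close> and zero for \<open>N = 0\<close>.
\<close>
lemma kernel_coeff_sum:
  fixes z :: complex
  assumes "x \<noteq> 0"
  shows "(of_real x - z) * (\<Sum>l<N. of_real (kernel_coeff a x l) * z ^ l) =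
         (\<Sum>j<N. of_real (a j) * z ^ j) - of_real (x * kernel_coeff a x N - a N) * z ^ N"
proof (induction N)
  case 0
  show ?case using assms by (simp add: kernel_coeff_altdef)
next
  case (Suc N)
  have "x * kernel_coeff a x (Suc N) - a (Suc N) = kernel_coeff a x N"
    using kernel_coeff_Suc[OF assms, of a N] by simp
  thus ?case
    by (simp only: sum.lessThan_Suc distrib_left Suc.IH) (simp add: algebra_simps)
qed

text \<open>
  By the telescoping identity, the left-hand side is the remainder of the expansion of \<open>F\<close> plus
  a multiple of \<open>z powr (N - \<alpha>)\<close>, divided by \<open>z - x\<close>, which stays away from zero near the origin.
\<close>
lemma quadrant_kernel_expansion:
  assumes "x > 0"
    and expansion: "(\<lambda>z. F z - (\<Sum>j<N. of_real (a j) * z powr of_real (real j - \<alpha>)))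
           \<in> O[at 0 within first_quadrant](\<lambda>z. z powr of_real (real N - \<alpha>))"
  shows "(\<lambda>z. F z / (z - of_real x) +
             (\<Sum>l<N. of_real (kernel_coeff a x l) * z powr of_real (real l - \<alpha>)))
           \<in> O[at 0 within first_quadrant](\<lambda>z. z powr of_real (real N - \<alpha>))"
proof -
  define \<rho> where "\<rho> = (\<lambda>z. F z - (\<Sum>j<N. of_real (a j) * z powr of_real (real j - \<alpha>)))"
  define e where "e = x * kernel_coeff a x N - a N"
  have ev: "\<forall>\<^sub>F z in at 0 within first_quadrant. z \<noteq> 0 \<and> z \<noteq> of_real x"
    using \<open>x > 0\<close> by (auto simp: eventually_at first_quadrant_def intro!: exI[of _ x])
  have inv: "(\<lambda>z. inverse (z - of_real x)) \<in> O[at 0 within first_quadrant](\<lambda>_. 1 :: complex)"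
  proof (rule bigoI_tendsto)
    show "((\<lambda>z. inverse (z - of_real x) / 1) \<longlongrightarrow> inverse (0 - complex_of_real x)) (at 0 within first_quadrant)"
      unfolding div_by_1 by (intro tendsto_inverse tendsto_diff tendsto_ident_at tendsto_const) (use \<open>x > 0\<close> in auto)
  qed auto
  have "(\<lambda>z. (\<rho> z + of_real e * z powr of_real (real N - \<alpha>)) * inverse (z - of_real x))
          \<in> O[at 0 within first_quadrant](\<lambda>z. z powr of_real (real N - \<alpha>) * 1)"
    using expansion by (intro landau_o.big.mult inv sum_in_bigo) (auto simp: \<rho>_def)
  thus ?thesis
  proof (rule iffD1[OF landau_o.big.cong_ex, rotated 2])
    show "\<forall>\<^sub>F z in at 0 within first_quadrant.
       (\<rho> z + of_real e * z powr of_real (real N - \<alpha>)) * inverse (z - of_real x) =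
       F z / (z - of_real x) + (\<Sum>l<N. of_real (kernel_coeff a x l) * z powr of_real (real l - \<alpha>))"
      using ev
    proof eventually_elim
      case (elim z)
      define S where "S = (\<Sum>l<N. of_real (kernel_coeff a x l) * z ^ l)"
      define A where "A = (\<Sum>j<N. of_real (a j) * z ^ j)"
      define w where "w = z powr (- of_real \<alpha>)"
      have pw: "z powr of_real (real j - \<alpha>) = w * z ^ j" for j
        using elim by (simp add: w_def powr_diff powr_minus field_simps)
      have "\<rho> z = F z - w * A"
        by (simp only: \<rho>_def pw A_def sum_distrib_left mult_ac)
      moreover have "(of_real x - z) * S = A - of_real e * z ^ N"
        unfolding S_def A_def e_def using \<open>x > 0\<close> by (intro kernel_coeff_sum) auto
      hence "A = (of_real x - z) * S + of_real e * z ^ N" by simp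
      moreover have "(\<Sum>l<N. of_real (kernel_coeff a x l) * z powr of_real (real l - \<alpha>)) = w * S"
        by (simp only: pw S_def sum_distrib_left mult_ac)
      ultimately show ?case
        using elim by (simp only: pw) (simp add: divide_simps, simp add: algebra_simps)
    qed
  qed auto
qed

section \<open>A primitive of the oscillatory Cauchy kernel\<close>

text \<open>
  The origin is an extreme point of the closed quadrant, so the set stays convex without it.
\<close>
lemma convex_first_quadrant: "convex first_quadrant"
proof (rule convexI)
  fix z w :: complex and u v :: real
  assume *: "z \<in> first_quadrant" "w \<in> first_quadrant" "0 \<le> u" "0 \<le> v" "u + v = 1"
  have "Re z + Im z > 0" "Re w + Im w > 0"
    using * by (auto simp: first_quadrant_def complex_eq_iff add_nonneg_eq_0_iff order.strict_iff_order)
  hence "u * (Re z + Im z) + v * (Re w + Im w) > 0"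
    using * by (cases "u = 0") (auto intro: add_pos_nonneg)
  hence "u *\<^sub>R z + v *\<^sub>R w \<noteq> 0"
    by (auto simp: complex_eq_iff algebra_simps)
  thus "u *\<^sub>R z + v *\<^sub>R w \<in> first_quadrant"
    using * by (auto simp: first_quadrant_def)
qed

definition cauchy_kernel :: "(complex \<Rightarrow> complex) \<Rightarrow> real \<Rightarrow> real \<Rightarrow> complex \<Rightarrow> complex" where
  "cauchy_kernel F \<omega> x z = exp (\<i> * of_real \<omega> * z) * F z / (z - of_real x)"

lemma osc_kernel_eq:
  assumes "F (of_real t) = of_real (f t)"
  shows "osc_kernel f \<omega> x t = cauchy_kernel F \<omega> x (of_real t)"
  using assms by (simp add: osc_kernel_def cauchy_kernel_def mult_ac)

text \<open>
  With \<open>G z = exp (\<i> \<omega> z) F z\<close>, the difference quotient \<open>Q z = (G z - G x) / (z - x)\<close> extends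
  continuously to the pole \<open>x\<close>, and the quadrant is convex, so Cauchy's theorem gives \<open>Q\<close> a primitive \<open>P\<close>
  there. What is left is \<open>G x / (z - x)\<close>, with primitive \<open>G x * Ln (- \<i> (z - x))\<close>: the
  rotation by \<open>- \<i>\<close> moves the branch cut to the ray from \<open>x\<close> straight down, which meets the
  quadrant only in \<open>x\<close>. At distance \<open>\<epsilon>\<close> on both sides of \<open>x\<close> the real parts of the logarithm agree and
  its imaginary parts are \<open>\<pi>/2\<close> and \<open>- \<pi>/2\<close>; this jump, half of \<open>2 * \<pi> * \<i>\<close> times
  the residue, produces the oscillating term of the theorem.
\<close>
lemma cauchy_kernel_primitive:
  assumes "x > 0" and hol: "F analytic_on first_quadrant"
  obtains W where
    "\<And>z. z \<in> first_quadrant \<Longrightarrow> z \<noteq> of_real x \<Longrightarrow>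
       (W has_field_derivative cauchy_kernel F \<omega> x z) (at z within first_quadrant)"
    "((\<lambda>\<epsilon>. W (of_real (x - \<epsilon>)) - W (of_real (x + \<epsilon>))) \<longlongrightarrow>
       \<i> * of_real pi * exp (\<i> * of_real (\<omega> * x)) * F (of_real x)) (at_right 0)"
proof -
  define G where "G = (\<lambda>z. exp (\<i> * of_real \<omega> * z) * F z)"
  have G: "G analytic_on first_quadrant"
    unfolding G_def by (intro analytic_intros hol)
  have dG: "(G has_field_derivative deriv G z) (at z)" if "z \<in> first_quadrant" for z
    using analytic_on_imp_differentiable_at[OF G that] by (simp add: DERIV_deriv_iff_field_differentiable)
  have xq: "of_real x \<in> first_quadrant"
    using \<open>x > 0\<close> by (simp add: first_quadrant_def)
  define Q where "Q = (\<lambda>z. if z = of_real x then deriv G (of_real x) else (G z - G (of_real x)) / (z - of_real x))"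
  have dQ: "Q field_differentiable at z" if "z \<in> first_quadrant" "z \<noteq> of_real x" for z
  proof (rule field_differentiable_transform_within[of "dist z (of_real x)" z UNIV])
    show "(\<lambda>z. (G z - G (of_real x)) / (z - of_real x)) field_differentiable at z"
      using that dG[OF that(1)]
      by (intro derivative_intros) (auto simp: field_differentiable_def)
  qed (use that in \<open>auto simp: Q_def dist_commute\<close>)
  have "continuous (at z within first_quadrant) Q" if z: "z \<in> first_quadrant" for z
  proof (cases "z = of_real x")
    case False
    thus ?thesis
      using field_differentiable_imp_continuous_at[OF dQ[OF z False]] continuous_at_imp_continuous_at_within by blast
  next
    case True
    have "((\<lambda>w. (G w - G z) / (w - z)) \<longlongrightarrow> deriv G z) (at z)"
      using dG[OF z] by (simp add: has_field_derivative_iff)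
    hence "(Q \<longlongrightarrow> deriv G z) (at z)"
      by (rule Lim_transform_eventually) (auto simp: eventually_at Q_def True intro!: exI[of _ 1])
    hence "(Q \<longlongrightarrow> Q z) (at z)"
      using True by (simp add: Q_def)
    thus ?thesis
      by (auto simp: continuous_within intro: tendsto_within_subset)
  qed
  hence cQ: "continuous_on first_quadrant Q"
    by (simp add: continuous_on_eq_continuous_within)
  obtain P where P: "\<And>z. z \<in> first_quadrant \<Longrightarrow> (P has_field_derivative Q z) (at z within first_quadrant)"
    using holomorphic_convex_primitive[of first_quadrant "{of_real x}" Q] convex_first_quadrant cQ dQ interior_subset
    by blast
  define W where "W = (\<lambda>z. P z + G (of_real x) * Ln (- \<i> * (z - of_real x)))"
  show ?thesis
  proof (rule that[of W])
    fix z assume z: "z \<in> first_quadrant" "z \<noteq> of_real x"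
    have ln: "- \<i> * (z - of_real x) \<notin> \<real>\<^sub>\<le>\<^sub>0"
      using z by (auto simp: complex_nonpos_Reals_iff first_quadrant_def complex_eq_iff)
    have "(W has_field_derivative (Q z + G (of_real x) * (inverse (- \<i> * (z - of_real x)) * (- \<i> * 1)))) (at z within first_quadrant)"
      unfolding W_def using ln
      by (auto intro!: derivative_eq_intros P z simp: field_simps)
    also have "inverse (- \<i> * (z - of_real x)) * (- \<i> * 1) = 1 / (z - of_real x)"
      by (simp only: inverse_mult_distrib) (simp add: mult_ac divide_inverse)
    also have "Q z + G (of_real x) * (1 / (z - of_real x)) = G z / (z - of_real x)"
      using z by (simp add: Q_def diff_divide_distrib)
    also have "\<dots> = cauchy_kernel F \<omega> x z"
      by (simp add: G_def cauchy_kernel_def)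
    finally show "(W has_field_derivative cauchy_kernel F \<omega> x z) (at z within first_quadrant)" .
  next
    have cP: "continuous_on first_quadrant P"
      using P by (rule DERIV_continuous_on)
    have ev: "\<forall>\<^sub>F \<epsilon> in at_right 0. 0 < \<epsilon> \<and> \<epsilon> < x"
      using \<open>x > 0\<close> eventually_at_right_real by force
    have "((\<lambda>\<epsilon>. P (of_real (x - \<epsilon>))) \<longlongrightarrow> P (of_real x)) (at_right 0)"
      by (rule continuous_on_tendsto_compose[OF cP _ xq])
         (use ev in \<open>auto intro!: tendsto_eq_intros elim!: eventually_mono simp: first_quadrant_def\<close>)
    moreover have "((\<lambda>\<epsilon>. P (of_real (x + \<epsilon>))) \<longlongrightarrow> P (of_real x)) (at_right 0)"
      by (rule continuous_on_tendsto_compose[OF cP _ xq])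
         (use ev in \<open>auto intro!: tendsto_eq_intros elim!: eventually_mono simp: first_quadrant_def complex_eq_iff\<close>)
    ultimately have "((\<lambda>\<epsilon>. P (of_real (x - \<epsilon>)) - P (of_real (x + \<epsilon>)) + G (of_real x) * (\<i> * of_real pi)) \<longlongrightarrow>
        P (of_real x) - P (of_real x) + G (of_real x) * (\<i> * of_real pi)) (at_right 0)"
      by (intro tendsto_intros)
    hence "((\<lambda>\<epsilon>. W (of_real (x - \<epsilon>)) - W (of_real (x + \<epsilon>))) \<longlongrightarrow>
        P (of_real x) - P (of_real x) + G (of_real x) * (\<i> * of_real pi)) (at_right 0)"
    proof (rule Lim_transform_eventually)
      show "\<forall>\<^sub>F \<epsilon> in at_right 0. P (of_real (x - \<epsilon>)) - P (of_real (x + \<epsilon>)) + G (of_real x) * (\<i> * of_real pi) =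
          W (of_real (x - \<epsilon>)) - W (of_real (x + \<epsilon>))"
        using ev
      proof eventually_elim
        case (elim \<epsilon>)
        have "Ln (\<i> * of_real \<epsilon>) - Ln (- \<i> * of_real \<epsilon>) = \<i> * of_real pi"
          using elim Ln_times_of_real[of \<epsilon> "\<i>"] Ln_times_of_real[of \<epsilon> "-\<i>"]
          by (simp add: mult.commute)
        hence "G (of_real x) * Ln (\<i> * of_real \<epsilon>) - G (of_real x) * Ln (- \<i> * of_real \<epsilon>) = G (of_real x) * (\<i> * of_real pi)"
          by (metis right_diff_distrib)
        thus ?case by (simp add: W_def)
      qed
    qed
    thus "((\<lambda>\<epsilon>. W (of_real (x - \<epsilon>)) - W (of_real (x + \<epsilon>))) \<longlongrightarrow>
       \<i> * of_real pi * exp (\<i> * of_real (\<omega> * x)) * F (of_real x)) (at_right 0)"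
      by (simp add: G_def mult_ac)
  qed
qed

lemma primitive_along_line:
  fixes p v :: complex
  assumes W: "\<And>z. z \<in> first_quadrant \<Longrightarrow> z \<noteq> of_real x \<Longrightarrow>
       (W has_field_derivative K z) (at z within first_quadrant)"
    and line: "\<And>s. s \<in> S \<Longrightarrow> p + of_real s * v \<in> first_quadrant"
    and s: "s \<in> S" "p + of_real s * v \<noteq> of_real x"
  shows "((\<lambda>s. W (p + of_real s * v)) has_vector_derivative (v * K (p + of_real s * v))) (at s within S)"
proof -
  let ?\<gamma> = "\<lambda>s. p + of_real s * v"
  have "((\<lambda>s. complex_of_real s) has_vector_derivative of_real 1) (at s within S)"
    by (intro has_vector_derivative_of_real DERIV_ident)
  hence "(?\<gamma> has_vector_derivative (0 + of_real 1 * v)) (at s within S)"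
    by (intro has_vector_derivative_add has_vector_derivative_const has_vector_derivative_mult_left)
  moreover have "(W has_field_derivative K (?\<gamma> s)) (at (?\<gamma> s) within ?\<gamma> ` S)"
    by (rule DERIV_subset[OF W]) (use line s in blast)+
  ultimately show ?thesis
    using field_vector_diff_chain_within[of ?\<gamma> "0 + of_real 1 * v" s S W] by (simp add: o_def)
qed

lemma primitive_real_axis:
  assumes W: "\<And>z. z \<in> first_quadrant \<Longrightarrow> z \<noteq> of_real x \<Longrightarrow>
       (W has_field_derivative K z) (at z within first_quadrant)"
    and "0 < a" "a \<le> b" "x \<notin> {a..b}"
  shows "((\<lambda>t. K (of_real t)) has_integral (W (of_real b) - W (of_real a))) {a..b}"
proof (rule fundamental_theorem_of_calculus)
  fix t assume t: "t \<in> {a..b}"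
  have "((\<lambda>t. W (0 + of_real t * 1)) has_vector_derivative (1 * K (0 + of_real t * 1))) (at t within {a..b})"
  proof (rule primitive_along_line[OF W])
    show "0 + of_real s * 1 \<in> first_quadrant" if "s \<in> {a..b}" for s
      using that \<open>0 < a\<close> by (auto simp: first_quadrant_def complex_eq_iff)
    show "0 + complex_of_real t * 1 \<noteq> of_real x"
      using t assms(4) by (auto simp del: atLeastAtMost_iff)
  qed (use t in auto)
  thus "((\<lambda>t. W (complex_of_real t)) has_vector_derivative K (of_real t)) (at t within {a..b})"
    by simp
qed (use assms in auto)

lemma primitive_imaginary_axis:
  assumes W: "\<And>z. z \<in> first_quadrant \<Longrightarrow> z \<noteq> of_real x \<Longrightarrow>
       (W has_field_derivative K z) (at z within first_quadrant)"
    and "x > 0" "y > 0"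
  shows "((\<lambda>y. W (\<i> * of_real y)) has_vector_derivative (\<i> * K (\<i> * of_real y))) (at y)"
proof -
  have "((\<lambda>y. W (0 + of_real y * \<i>)) has_vector_derivative (\<i> * K (0 + of_real y * \<i>))) (at y within {0<..})"
  proof (rule primitive_along_line[OF W])
    show "0 + of_real s * \<i> \<in> first_quadrant" if "s \<in> {0<..}" for s
      using that by (auto simp: first_quadrant_def complex_eq_iff)
    show "0 + of_real y * \<i> \<noteq> of_real x"
      using \<open>y > 0\<close> by (simp add: complex_eq_iff)
  qed (use \<open>y > 0\<close> in auto)
  moreover have "at y within {0<..} = at y"
    using \<open>y > 0\<close> by (intro at_within_open) auto
  ultimately show ?thesis
    by (simp add: mult.commute)
qed

section \<open>Decay along the chords between the two axes\<close>

text \<open>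
  The segment from \<open>\<tau>\<close> to \<open>\<i> \<tau>\<close>, traversed for \<open>s\<close> from 0 to 1. It replaces the
  quarter circle of the usual contour.
\<close>
definition chord :: "real \<Rightarrow> real \<Rightarrow> complex" where
  "chord \<tau> s = of_real \<tau> + of_real s * (of_real \<tau> * (\<i> - 1))"

lemma chord_bounds:
  assumes "\<tau> > 0" "s \<in> {0..1}"
  shows "chord \<tau> s \<in> first_quadrant" "norm (chord \<tau> s) \<le> \<tau>" "\<tau> / 2 \<le> norm (chord \<tau> s)"
proof -
  have Re: "Re (chord \<tau> s) = \<tau> * (1 - s)" and Im: "Im (chord \<tau> s) = \<tau> * s"
    by (simp_all add: chord_def algebra_simps)
  have pos: "Re (chord \<tau> s) \<ge> 0" "Im (chord \<tau> s) \<ge> 0"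
    using assms unfolding Re Im by auto
  have sum: "Re (chord \<tau> s) + Im (chord \<tau> s) = \<tau>"
    unfolding Re Im by (simp add: algebra_simps)
  show "norm (chord \<tau> s) \<le> \<tau>"
    using cmod_le[of "chord \<tau> s"] pos sum by simp
  show half: "\<tau> / 2 \<le> norm (chord \<tau> s)"
    using abs_Re_le_cmod[of "chord \<tau> s"] abs_Im_le_cmod[of "chord \<tau> s"] pos sum by simp
  hence "chord \<tau> s \<noteq> 0"
    using \<open>\<tau> > 0\<close> by (intro notI) simp
  thus "chord \<tau> s \<in> first_quadrant"
    using pos by (simp add: first_quadrant_def)
qed

text \<open>
  The speed \<open>norm (\<tau> * (\<i> - 1))\<close> of the chord is at most \<open>2 * \<tau>\<close>. Stating the bound through
  an antiderivative \<open>B\<close> of the estimate spares an integral along the chord.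
\<close>
lemma primitive_chord_bound:
  assumes W: "\<And>z. z \<in> first_quadrant \<Longrightarrow> z \<noteq> of_real x \<Longrightarrow>
       (W has_field_derivative K z) (at z within first_quadrant)"
    and "\<tau> > 0" "\<tau> \<noteq> x"
    and B: "\<And>s. s \<in> {0..1} \<Longrightarrow> (B has_vector_derivative B' s) (at s)"
    and bnd: "\<And>s. s \<in> {0..1} \<Longrightarrow> 2 * \<tau> * norm (K (chord \<tau> s)) \<le> B' s"
  shows "norm (W (\<i> * of_real \<tau>) - W (of_real \<tau>)) \<le> B 1 - B 0"
proof -
  have der: "((\<lambda>s. W (chord \<tau> s)) has_vector_derivative (of_real \<tau> * (\<i> - 1) * K (chord \<tau> s))) (at s within {0..1})"
    if s: "s \<in> {0..1}" for s
  proof -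
    have "chord \<tau> s \<noteq> of_real x"
      using assms(2,3) by (auto simp: chord_def complex_eq_iff)
    thus ?thesis
      using s chord_bounds(1)[OF \<open>\<tau> > 0\<close>] unfolding chord_def
      by (intro primitive_along_line[OF W]) auto
  qed
  have "norm (W (chord \<tau> 1) - W (chord \<tau> 0)) \<le> B 1 - B 0"
  proof (rule differentiable_bound_general[where f' = "\<lambda>s. of_real \<tau> * (\<i> - 1) * K (chord \<tau> s)" and \<phi>' = B'])
    show "continuous_on {0..1} (\<lambda>s. W (chord \<tau> s))"
      using der by (intro continuous_on_vector_derivative)
    show "continuous_on {0..1} B"
      using B by (intro continuous_on_vector_derivative) (auto intro: has_vector_derivative_at_within)
    fix s :: real assume s: "0 < s" "s < 1"
    show "((\<lambda>s. W (chord \<tau> s)) has_vector_derivative (of_real \<tau> * (\<i> - 1) * K (chord \<tau> s))) (at s)"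
      using der[of s] s by (simp add: at_within_Icc_at)
    show "(B has_vector_derivative B' s) (at s)"
      using B s by simp
    have "norm (of_real \<tau> * (\<i> - 1) * K (chord \<tau> s)) \<le> \<tau> * 2 * norm (K (chord \<tau> s))"
      unfolding norm_mult using \<open>\<tau> > 0\<close> norm_triangle_ineq4[of \<i> 1]
      by (intro mult_mono) auto
    thus "norm (of_real \<tau> * (\<i> - 1) * K (chord \<tau> s)) \<le> B' s"
      using bnd[of s] s by (simp add: mult_ac)
  qed auto
  thus ?thesis by (simp add: chord_def algebra_simps)
qed

text \<open>
  On the chord the kernel is at most of order \<open>\<tau> powr (- \<alpha>)\<close> and the chord has length of order \<open>\<tau>\<close>, so the
  contribution is of order \<open>\<tau> powr (1 - \<alpha>)\<close>.
\<close>
lemma primitive_chord_origin: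
  fixes F :: "complex \<Rightarrow> complex"
  assumes "x > 0" "\<omega> > 0" "0 \<le> \<alpha>" "\<alpha> < 1"
    and W: "\<And>z. z \<in> first_quadrant \<Longrightarrow> z \<noteq> of_real x \<Longrightarrow>
       (W has_field_derivative cauchy_kernel F \<omega> x z) (at z within first_quadrant)"
    and orig: "(\<lambda>z. F z / (z - of_real x)) \<in> O[at 0 within first_quadrant](\<lambda>z. z powr of_real (- \<alpha>))"
  shows "((\<lambda>\<tau>. W (\<i> * of_real \<tau>) - W (of_real \<tau>)) \<longlongrightarrow> 0) (at_right 0)"
proof -
  obtain C where "C > 0" and
    "\<forall>\<^sub>F z in at 0 within first_quadrant. norm (F z / (z - of_real x)) \<le> C * norm (z powr of_real (- \<alpha>))"
    using landau_o.bigE[OF orig] by blast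
  then obtain r where "r > 0" and r:
    "\<And>z. z \<in> first_quadrant \<Longrightarrow> norm z < r \<Longrightarrow> norm (F z / (z - of_real x)) \<le> C * norm (z powr of_real (- \<alpha>))"
    by (auto simp: eventually_at first_quadrant_def)
  have "\<forall>\<^sub>F \<tau> in at_right 0. \<tau> \<in> {0<..<min r x}"
    by (rule eventually_at_right_real) (use \<open>r > 0\<close> \<open>x > 0\<close> in auto)
  hence "\<forall>\<^sub>F \<tau> in at_right 0. norm (W (\<i> * of_real \<tau>) - W (of_real \<tau>)) \<le> 2 * C * 2 powr \<alpha> * \<tau> powr (1 - \<alpha>)"
  proof eventually_elim
    case (elim \<tau>)
    have "norm (W (\<i> * of_real \<tau>) - W (of_real \<tau>)) \<le>
        2 * C * 2 powr \<alpha> * \<tau> powr (1 - \<alpha>) * 1 - 2 * C * 2 powr \<alpha> * \<tau> powr (1 - \<alpha>) * 0"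
    proof (rule primitive_chord_bound[OF W, where B' = "\<lambda>_. 2 * C * 2 powr \<alpha> * \<tau> powr (1 - \<alpha>)"])
      fix s :: real assume s: "s \<in> {0..1}"
      let ?z = "chord \<tau> s"
      have z: "?z \<in> first_quadrant" "norm ?z < r" "\<tau> / 2 \<le> norm ?z" "Im ?z \<ge> 0"
        using chord_bounds[of \<tau> s] s elim by (auto simp: first_quadrant_def)
      have "norm (exp (\<i> * of_real \<omega> * ?z)) \<le> 1"
        using z(4) \<open>\<omega> > 0\<close> by (simp add: norm_exp_eq_Re)
      hence "norm (cauchy_kernel F \<omega> x ?z) \<le> 1 * norm (F ?z / (?z - of_real x))"
        unfolding cauchy_kernel_def times_divide_eq_right [symmetric] norm_mult by (rule mult_right_mono) auto
      also have "\<dots> \<le> C * norm (?z powr of_real (- \<alpha>))"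
        using r[OF z(1,2)] by simp
      also have "norm (?z powr of_real (- \<alpha>)) = norm ?z powr (- \<alpha>)"
        by (subst norm_powr_real_powr') auto
      also have "norm ?z powr (- \<alpha>) \<le> (\<tau> / 2) powr (- \<alpha>)"
        using elim z(3) \<open>0 \<le> \<alpha>\<close> by (intro powr_mono2') auto
      also have "(\<tau> / 2) powr (- \<alpha>) = 2 powr \<alpha> * \<tau> powr (- \<alpha>)"
        using elim by (simp add: powr_divide powr_minus divide_simps)
      finally have "2 * \<tau> * norm (cauchy_kernel F \<omega> x ?z) \<le> 2 * \<tau> * (C * (2 powr \<alpha> * \<tau> powr (- \<alpha>)))"
        using elim \<open>C > 0\<close> by (intro mult_left_mono) auto
      also have "\<dots> = 2 * C * 2 powr \<alpha> * \<tau> powr (1 - \<alpha>)"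
        using elim by (simp add: powr_diff powr_minus field_simps)
      finally show "2 * \<tau> * norm (cauchy_kernel F \<omega> x ?z) \<le> 2 * C * 2 powr \<alpha> * \<tau> powr (1 - \<alpha>)" .
    next
      fix s :: real
      show "((\<lambda>s. 2 * C * 2 powr \<alpha> * \<tau> powr (1 - \<alpha>) * s) has_vector_derivative 2 * C * 2 powr \<alpha> * \<tau> powr (1 - \<alpha>)) (at s)"
        by (rule derivative_eq_intros refl | simp)+
    qed (use elim in auto)
    thus ?case by simp
  qed
  moreover have "((\<lambda>\<tau>. 2 * C * 2 powr \<alpha> * \<tau> powr (1 - \<alpha>)) \<longlongrightarrow> 0) (at_right 0)"
    by (intro tendsto_mult_right_zero) (use \<open>\<alpha> < 1\<close> in real_asymp)
  ultimately show ?thesis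
    by (rule Lim_null_comparison)
qed

text \<open>
  This is Jordan's lemma for the chord. At parameter \<open>s\<close> the imaginary part is \<open>\<tau> * s\<close>, so the
  kernel times the speed is at most a multiple of \<open>\<tau> powr \<delta> * exp (- (\<omega> - d) * \<tau> * s)\<close>. Integrating the
  exponential over \<open>s\<close> gains a factor \<open>1 / \<tau>\<close>, and \<open>\<tau> powr (\<delta> - 1)\<close> tends to zero.
\<close>
lemma primitive_chord_infinity:
  fixes F :: "complex \<Rightarrow> complex"
  assumes "x > 0" "\<omega> > d" "\<delta> < 1" "M > 0"
    and W: "\<And>z. z \<in> first_quadrant \<Longrightarrow> z \<noteq> of_real x \<Longrightarrow>
       (W has_field_derivative cauchy_kernel F \<omega> x z) (at z within first_quadrant)"
    and growth: "\<forall>z\<in>first_quadrant. norm z \<ge> R \<longrightarrow>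
           norm (F z) \<le> M * norm z powr \<delta> * exp (d * Im z)"
  shows "((\<lambda>\<tau>. W (\<i> * of_real \<tau>) - W (of_real \<tau>)) \<longlongrightarrow> 0) at_top"
proof -
  define c where "c = \<omega> - d"
  have c: "c > 0" using assms by (simp add: c_def)
  \<comment> \<open>2 from the speed of the chord, 4 from \<open>norm (z - x) \<ge> \<tau> / 4\<close>, and the power of 2 from
    \<open>\<tau> / 2 \<le> norm z \<le> \<tau>\<close>, for either sign of \<open>\<delta>\<close>\<close>
  define C where "C = 8 * M * 2 powr \<bar>\<delta>\<bar>"
  have C: "C > 0" using \<open>M > 0\<close> by (simp add: C_def)
  have "\<forall>\<^sub>F \<tau> in at_top. norm (W (\<i> * of_real \<tau>) - W (of_real \<tau>)) \<le> C / c * \<tau> powr (\<delta> - 1)"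
    using eventually_ge_at_top[of "4 * x"] eventually_ge_at_top[of "2 * R"]
  proof eventually_elim
    case (elim \<tau>)
    have \<tau>: "\<tau> > 0" using elim \<open>x > 0\<close> by linarith
    define A where "A = C * \<tau> powr \<delta> / (c * \<tau>)"
    have A: "A \<ge> 0" "A * (c * \<tau>) = C * \<tau> powr \<delta>"
      using C c \<tau> by (auto simp: A_def)
    have "norm (W (\<i> * of_real \<tau>) - W (of_real \<tau>)) \<le>
        - (A * exp (- (c * \<tau> * 1))) - (- (A * exp (- (c * \<tau> * 0))))"
    proof (rule primitive_chord_bound[OF W, where B' = "\<lambda>s. C * \<tau> powr \<delta> * exp (- (c * \<tau> * s))"])
      fix s :: real assume s: "s \<in> {0..1}"
      let ?z = "chord \<tau> s"
      have z: "?z \<in> first_quadrant" "norm ?z \<le> \<tau>" "\<tau> / 2 \<le> norm ?z"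
        using chord_bounds[of \<tau> s] s \<tau> by auto
      have Im: "Im ?z = \<tau> * s" by (simp add: chord_def)
      have pw: "norm ?z powr \<delta> \<le> 2 powr \<bar>\<delta>\<bar> * \<tau> powr \<delta>"
      proof (cases "\<delta> \<ge> 0")
        case True
        have "norm ?z powr \<delta> \<le> 1 * \<tau> powr \<delta>"
          using True z by (simp add: powr_mono2)
        also have "\<dots> \<le> 2 powr \<bar>\<delta>\<bar> * \<tau> powr \<delta>"
          by (intro mult_right_mono) (auto intro: ge_one_powr_ge_zero)
        finally show ?thesis .
      next
        case False
        have "norm ?z powr \<delta> \<le> (\<tau> / 2) powr \<delta>"
          using False z \<tau> by (intro powr_mono2') auto
        also have "\<dots> = 2 powr \<bar>\<delta>\<bar> * \<tau> powr \<delta>"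
          using False \<tau> by (simp add: powr_divide powr_minus divide_simps)
        finally show ?thesis .
      qed
      have "norm (F ?z) \<le> M * norm ?z powr \<delta> * exp (d * Im ?z)"
        using growth z elim by auto
      also have "\<dots> \<le> M * (2 powr \<bar>\<delta>\<bar> * \<tau> powr \<delta>) * exp (d * (\<tau> * s))"
        unfolding Im using \<open>M > 0\<close> pw by (intro mult_right_mono mult_left_mono) auto
      finally have "norm (exp (\<i> * of_real \<omega> * ?z)) * norm (F ?z) \<le>
          exp (- (\<omega> * (\<tau> * s))) * (M * (2 powr \<bar>\<delta>\<bar> * \<tau> powr \<delta>) * exp (d * (\<tau> * s)))"
        by (intro mult_mono) (auto simp: norm_exp_eq_Re Im)
      also have "\<dots> = M * (2 powr \<bar>\<delta>\<bar> * \<tau> powr \<delta>) * exp (- (c * \<tau> * s))"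
        by (simp add: c_def algebra_simps flip: exp_add)
      finally have num: "norm (exp (\<i> * of_real \<omega> * ?z)) * norm (F ?z) \<le> M * (2 powr \<bar>\<delta>\<bar> * \<tau> powr \<delta>) * exp (- (c * \<tau> * s))" .
      have den: "\<tau> / 4 \<le> norm (?z - of_real x)"
        using norm_triangle_ineq2[of ?z "of_real x"] z(3) elim \<open>x > 0\<close> by simp
      have "norm (cauchy_kernel F \<omega> x ?z) \<le> (M * (2 powr \<bar>\<delta>\<bar> * \<tau> powr \<delta>) * exp (- (c * \<tau> * s))) / (\<tau> / 4)"
        unfolding cauchy_kernel_def norm_divide norm_mult
        using num den \<tau> \<open>M > 0\<close> by (intro frac_le) auto
      hence "2 * \<tau> * norm (cauchy_kernel F \<omega> x ?z) \<le> 2 * \<tau> * ((M * (2 powr \<bar>\<delta>\<bar> * \<tau> powr \<delta>) * exp (- (c * \<tau> * s))) / (\<tau> / 4))"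
        using \<tau> by (intro mult_left_mono) auto
      also have "\<dots> = C * \<tau> powr \<delta> * exp (- (c * \<tau> * s))"
        using \<tau> by (simp add: C_def field_simps)
      finally show "2 * \<tau> * norm (cauchy_kernel F \<omega> x ?z) \<le> C * \<tau> powr \<delta> * exp (- (c * \<tau> * s))" .
    next
      fix s :: real
      show "((\<lambda>s. - (A * exp (- (c * \<tau> * s)))) has_vector_derivative C * \<tau> powr \<delta> * exp (- (c * \<tau> * s))) (at s)"
        unfolding has_real_derivative_iff_has_vector_derivative [symmetric]
        unfolding A(2) [symmetric]
        by (rule derivative_eq_intros refl)+ (simp add: mult_ac)
    qed (use elim \<tau> \<open>x > 0\<close> in auto)
    also have "\<dots> \<le> A"
      using A(1) by simp
    also have "\<dots> = C / c * \<tau> powr (\<delta> - 1)"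
      using \<tau> by (simp add: A_def powr_diff)
    finally show ?case .
  qed
  moreover have "((\<lambda>\<tau>. C / c * \<tau> powr (\<delta> - 1)) \<longlongrightarrow> 0) at_top"
    using \<open>\<delta> < 1\<close> by (intro tendsto_mult_right_zero tendsto_neg_powr filterlim_ident) auto
  ultimately show ?thesis
    by (rule Lim_null_comparison)
qed

section \<open>Rotation of the principal value integral\<close>

text \<open>
  Both ends of the half-line are approached with one parameter, which lets the chords near the
  origin and near infinity be treated in a single limit.
\<close>
lemma FTC_half_line:
  fixes T t :: "real \<Rightarrow> complex"
  assumes der: "\<And>y. y > 0 \<Longrightarrow> (T has_vector_derivative t y) (at y)"
    and int: "t absolutely_integrable_on {0<..}"
  shows "((\<lambda>R. T R - T (1 / R)) \<longlongrightarrow> integral {0<..} t) at_top"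
proof -
  have sub: "set_integrable lebesgue {1/R..R} t" if "R > 0" for R
  proof (rule set_integrable_subset[OF int])
    have "1 / R > 0" using that by simp
    thus "{1/R..R} \<subseteq> {0<..}" by (auto simp del: zero_less_divide_1_iff)
  qed auto
  have "((\<lambda>R. integral\<^sup>L lebesgue (\<lambda>y. indicator {1/R..R} y *\<^sub>R (indicator {0<..} y *\<^sub>R t y))) \<longlongrightarrow>
         integral\<^sup>L lebesgue (\<lambda>y. indicator {0<..} y *\<^sub>R t y)) at_top"
  proof (rule integral_dominated_convergence_at_top)
    show m: "(\<lambda>y. indicator {0<..} y *\<^sub>R t y) \<in> borel_measurable lebesgue"
      using int by (auto simp: set_integrable_def)
    show "(\<lambda>y. indicator {1/R..R} y *\<^sub>R (indicator {0<..} y *\<^sub>R t y)) \<in> borel_measurable lebesgue" for R :: real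
      by (intro borel_measurable_scaleR borel_measurable_indicator m) auto
    show "integrable lebesgue (\<lambda>y. norm (indicator {0<..} y *\<^sub>R t y))"
      using int unfolding set_integrable_def by (rule integrable_norm)
    show "\<forall>\<^sub>F R in at_top. AE y in lebesgue. norm (indicator {1/R..R} y *\<^sub>R (indicator {0<..} y *\<^sub>R t y)) \<le> norm (indicator {0<..} y *\<^sub>R t y)"
      by (intro always_eventually allI AE_I2) (auto simp: indicator_def)
    show "AE y in lebesgue. ((\<lambda>R. indicator {1/R..R} y *\<^sub>R (indicator {0<..} y *\<^sub>R t y)) \<longlongrightarrow> indicator {0<..} y *\<^sub>R t y) at_top"
    proof (intro AE_I2)
      fix y :: real
      show "((\<lambda>R. indicator {1/R..R} y *\<^sub>R (indicator {0<..} y *\<^sub>R t y)) \<longlongrightarrow> indicator {0<..} y *\<^sub>R t y) at_top"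
      proof (cases "y > 0")
        case True
        have "\<forall>\<^sub>F R in at_top. indicator {1/R..R} y *\<^sub>R (indicator {0<..} y *\<^sub>R t y) = indicator {0<..} y *\<^sub>R t y"
          using eventually_ge_at_top[of y] eventually_ge_at_top[of "1/y"] eventually_gt_at_top[of 0]
          by eventually_elim (use True in \<open>auto simp: indicator_def field_simps\<close>)
        thus ?thesis by (rule tendsto_eventually)
      qed auto
    qed
  qed
  also have "integral\<^sup>L lebesgue (\<lambda>y. indicator {0<..} y *\<^sub>R t y) = integral {0<..} t"
    using set_lebesgue_integral_eq_integral(2)[OF int] by (simp add: set_lebesgue_integral_def)
  finally show ?thesis
  proof (rule Lim_transform_eventually)
    show "\<forall>\<^sub>F R in at_top. integral\<^sup>L lebesgue (\<lambda>y. indicator {1/R..R} y *\<^sub>R (indicator {0<..} y *\<^sub>R t y)) = T R - T (1 / R)"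
      using eventually_gt_at_top[of 1]
    proof eventually_elim
      case (elim R)
      have "1 / R \<le> R" "1 / R > 0" using elim by (auto simp: divide_simps) (smt (verit) mult_less_cancel_left1)
      have "(\<lambda>y. indicator {1/R..R} y *\<^sub>R (indicator {0<..} y *\<^sub>R t y)) = (\<lambda>y. indicator {1/R..R} y *\<^sub>R t y)"
        using less_le_trans[OF \<open>1 / R > 0\<close>] by (auto simp: fun_eq_iff indicator_def)
      hence "integral\<^sup>L lebesgue (\<lambda>y. indicator {1/R..R} y *\<^sub>R (indicator {0<..} y *\<^sub>R t y)) = integral {1/R..R} t"
        using set_lebesgue_integral_eq_integral(2)[OF sub[of R]] elim by (simp add: set_lebesgue_integral_def)
      also have "(t has_integral (T R - T (1 / R))) {1/R..R}"
        by (rule fundamental_theorem_of_calculus)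
           (use \<open>1 / R \<le> R\<close> \<open>1 / R > 0\<close> in \<open>auto intro!: has_vector_derivative_at_within[OF der] intro: less_le_trans[OF \<open>1 / R > 0\<close>]\<close>)
      hence "integral {1/R..R} t = T R - T (1 / R)" by (rule integral_unique)
      finally show ?case .
    qed
  qed
qed

lemma osc_kernel_integrable:
  assumes "f absolutely_integrable_on {0..b}" "b < x"
  shows "osc_kernel f \<omega> x integrable_on {0..b}"
proof -
  define k where "k = (\<lambda>t. exp (\<i> * of_real (\<omega> * t)) / of_real (t - x))"
  have k: "continuous_on {0..b} k"
    unfolding k_def using \<open>b < x\<close> by (intro continuous_intros) auto
  have "(\<lambda>t. f t *\<^sub>R k t) absolutely_integrable_on {0..b}"
  proof (rule absolutely_integrable_bounded_measurable_product[where h = "\<lambda>c r. r *\<^sub>R c"])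
    show "bilinear (\<lambda>c r. r *\<^sub>R (c :: complex))"
      by (auto simp: bilinear_def algebra_simps intro!: linearI)
    show "k \<in> borel_measurable (lebesgue_on {0..b})"
      by (rule continuous_imp_measurable_on_sets_lebesgue[OF k]) auto
    show "bounded (k ` {0..b})"
      by (intro compact_imp_bounded compact_continuous_image k) auto
  qed (use assms in auto)
  hence "(\<lambda>t. f t *\<^sub>R k t) integrable_on {0..b}"
    by (rule set_lebesgue_integral_eq_integral)
  also have "(\<lambda>t. f t *\<^sub>R k t) = osc_kernel f \<omega> x"
    by (simp add: fun_eq_iff k_def osc_kernel_def scaleR_conv_of_real)
  finally show ?thesis .
qed

text \<open>
  Every integral in sight is a difference of values of one primitive \<open>W\<close> of the kernel. On the real axis
  \<open>W\<close> has a limit \<open>A\<close> at the origin because \<open>f\<close> is integrable there. The increments of \<open>W\<close>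
  on the real and on the imaginary axis differ by increments along chords, which vanish in the limit, so
  \<open>W\<close> tends to \<open>V + A\<close> at infinity, where \<open>V\<close> is the integral over the imaginary axis. Hence the integral with
  \<open>(x - \<epsilon>, x + \<epsilon>)\<close> removed is \<open>V + W (x - \<epsilon>) - W (x + \<epsilon>)\<close>, and the jump of \<open>W\<close> at
  \<open>x\<close> gives its limit.
\<close>
lemma has_osc_hilbert_rotated:
  assumes "x > 0" "\<omega> > 0"
    and int: "\<And>b. f absolutely_integrable_on {0..b}"
    and hol: "F analytic_on first_quadrant"
    and Ff: "\<And>t. t > 0 \<Longrightarrow> F (of_real t) = of_real (f t)"
    and "M > 0" "\<delta> < 1" "\<omega> > d"
    and growth: "\<forall>z\<in>first_quadrant. norm z \<ge> R \<longrightarrow>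
           norm (F z) \<le> M * norm z powr \<delta> * exp (d * Im z)"
    and "0 \<le> \<alpha>" "\<alpha> < 1"
    and orig: "(\<lambda>z. F z / (z - of_real x)) \<in> O[at 0 within first_quadrant](\<lambda>z. z powr of_real (- \<alpha>))"
    and ray: "(\<lambda>y. \<i> * cauchy_kernel F \<omega> x (\<i> * of_real y)) absolutely_integrable_on {0<..}"
  shows "has_osc_hilbert f \<omega> x (\<i> * of_real pi * exp (\<i> * of_real (\<omega> * x)) * of_real (f x) +
           integral {0<..} (\<lambda>y. \<i> * cauchy_kernel F \<omega> x (\<i> * of_real y)))"
proof -
  let ?K = "osc_kernel f \<omega> x"
  define V where "V = integral {0<..} (\<lambda>y. \<i> * cauchy_kernel F \<omega> x (\<i> * of_real y))"
  obtain W where W: "\<And>z. z \<in> first_quadrant \<Longrightarrow> z \<noteq> of_real x \<Longrightarrow>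
       (W has_field_derivative cauchy_kernel F \<omega> x z) (at z within first_quadrant)"
    and jump: "((\<lambda>\<epsilon>. W (of_real (x - \<epsilon>)) - W (of_real (x + \<epsilon>))) \<longlongrightarrow>
       \<i> * of_real pi * exp (\<i> * of_real (\<omega> * x)) * F (of_real x)) (at_right 0)"
    using cauchy_kernel_primitive[OF \<open>x > 0\<close> hol, of \<omega>] by blast
  have W_real: "(?K has_integral (W (of_real b) - W (of_real a))) {a..b}"
    if "0 < a" "a \<le> b" "x \<notin> {a..b}" for a b
  proof (rule has_integral_eq)
    show "((\<lambda>t. cauchy_kernel F \<omega> x (of_real t)) has_integral (W (of_real b) - W (of_real a))) {a..b}"
      by (rule primitive_real_axis[OF W]) (use that in auto)
    show "cauchy_kernel F \<omega> x (of_real t) = ?K t" if "t \<in> {a..b}" for t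
      using that \<open>0 < a\<close> by (intro osc_kernel_eq [symmetric] Ff) auto
  qed

  have near0: "((\<lambda>\<tau>. W (of_real \<tau>)) \<longlongrightarrow> W (of_real b) - integral {0..b} ?K) (at_right 0)"
    if b: "0 < b" "b < x" for b
  proof -
    have "continuous_on {0..b} (\<lambda>\<tau>. integral {\<tau>..b} ?K)"
      by (intro indefinite_integral_continuous_1' osc_kernel_integrable int b)
    hence "((\<lambda>\<tau>. integral {\<tau>..b} ?K) \<longlongrightarrow> integral {0..b} ?K) (at 0 within {0..b})"
      using b by (simp add: continuous_on)
    hence "((\<lambda>\<tau>. integral {\<tau>..b} ?K) \<longlongrightarrow> integral {0..b} ?K) (at_right 0)"
      using b by (simp add: at_within_Icc_at_right)
    hence "((\<lambda>\<tau>. W (of_real b) - integral {\<tau>..b} ?K) \<longlongrightarrow> W (of_real b) - integral {0..b} ?K) (at_right 0)"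
      by (intro tendsto_intros)
    thus ?thesis
    proof (rule Lim_transform_eventually)
      have "\<forall>\<^sub>F \<tau> in at_right 0. \<tau> \<in> {0<..<b}"
        by (rule eventually_at_right_real[OF b(1)])
      thus "\<forall>\<^sub>F \<tau> in at_right 0. W (of_real b) - integral {\<tau>..b} ?K = W (of_real \<tau>)"
      proof eventually_elim
        case (elim \<tau>)
        have "integral {\<tau>..b} ?K = W (of_real b) - W (of_real \<tau>)"
          by (intro integral_unique W_real) (use elim b in auto)
        thus ?case by simp
      qed
    qed
  qed
  \<comment> \<open>the value does not depend on the chosen point \<open>x / 2\<close>, by uniqueness of the limit\<close>
  define A where "A = W (of_real (x / 2)) - integral {0..x / 2} ?K"
  have A: "((\<lambda>\<tau>. W (of_real \<tau>)) \<longlongrightarrow> A) (at_right 0)"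
    unfolding A_def by (rule near0) (use \<open>x > 0\<close> in auto)
  have left: "integral {0..b} ?K = W (of_real b) - A" if "0 < b" "b < x" for b
    using tendsto_unique[OF trivial_limit_at_right_real near0[OF that] A] by (simp add: algebra_simps)

  have chord0: "((\<lambda>\<tau>. W (\<i> * of_real \<tau>) - W (of_real \<tau>)) \<longlongrightarrow> 0) (at_right 0)"
    by (rule primitive_chord_origin[OF \<open>x > 0\<close> \<open>\<omega> > 0\<close> \<open>0 \<le> \<alpha>\<close> \<open>\<alpha> < 1\<close> W orig])
  have chordinf: "((\<lambda>\<tau>. W (\<i> * of_real \<tau>) - W (of_real \<tau>)) \<longlongrightarrow> 0) at_top"
    by (rule primitive_chord_infinity[OF \<open>x > 0\<close> \<open>\<omega> > d\<close> \<open>\<delta> < 1\<close> \<open>M > 0\<close> W growth])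
  have inv: "filterlim (\<lambda>R::real. 1 / R) (at_right 0) at_top"
    using filterlim_inverse_at_right_top by (simp add: inverse_eq_divide)
  have "((\<lambda>R. W (\<i> * of_real R) - W (\<i> * of_real (1 / R))) \<longlongrightarrow> V) at_top"
    unfolding V_def
    by (rule FTC_half_line[where T = "\<lambda>y. W (\<i> * of_real y)", OF primitive_imaginary_axis[OF W \<open>x > 0\<close>] ray])
  hence "((\<lambda>R. (W (\<i> * of_real R) - W (\<i> * of_real (1 / R))) - (W (\<i> * of_real R) - W (of_real R)) +
      (W (\<i> * of_real (1 / R)) - W (of_real (1 / R))) + W (of_real (1 / R))) \<longlongrightarrow> V - 0 + 0 + A) at_top"
    by (intro tendsto_intros chordinf filterlim_compose[OF chord0 inv] filterlim_compose[OF A inv])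
  hence Winf: "((\<lambda>R. W (of_real R)) \<longlongrightarrow> V + A) at_top"
    by simp

  have right: "has_improper_integral ?K (x + \<epsilon>) (V + A - W (of_real (x + \<epsilon>)))" if "\<epsilon> > 0" for \<epsilon>
    unfolding has_improper_integral_def
  proof (intro conjI allI impI)
    have *: "(?K has_integral (W (of_real R) - W (of_real (x + \<epsilon>)))) {x + \<epsilon>..R}" if "R \<ge> x + \<epsilon>" for R
      using that \<open>\<epsilon> > 0\<close> \<open>x > 0\<close> by (intro W_real) auto
    show "?K integrable_on {x + \<epsilon>..R}" if "R \<ge> x + \<epsilon>" for R
      using *[OF that] by (rule has_integral_integrable)
    have "((\<lambda>R. W (of_real R) - W (of_real (x + \<epsilon>))) \<longlongrightarrow> V + A - W (of_real (x + \<epsilon>))) at_top"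
      by (intro tendsto_intros Winf)
    thus "((\<lambda>R. integral {x + \<epsilon>..R} ?K) \<longlongrightarrow> V + A - W (of_real (x + \<epsilon>))) at_top"
    proof (rule Lim_transform_eventually)
      show "\<forall>\<^sub>F R in at_top. W (of_real R) - W (of_real (x + \<epsilon>)) = integral {x + \<epsilon>..R} ?K"
        using eventually_ge_at_top[of "x + \<epsilon>"]
        by eventually_elim (rule integral_unique[OF *, symmetric])
    qed
  qed
  have "((\<lambda>\<epsilon>. W (of_real (x - \<epsilon>)) - W (of_real (x + \<epsilon>)) + V) \<longlongrightarrow>
       \<i> * of_real pi * exp (\<i> * of_real (\<omega> * x)) * F (of_real x) + V) (at_right 0)"
    by (intro tendsto_intros jump)
  hence lim: "((\<lambda>\<epsilon>. integral {0..x - \<epsilon>} ?K + (V + A - W (of_real (x + \<epsilon>)))) \<longlongrightarrow>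
       \<i> * of_real pi * exp (\<i> * of_real (\<omega> * x)) * F (of_real x) + V) (at_right 0)"
  proof (rule Lim_transform_eventually)
    have "\<forall>\<^sub>F \<epsilon> in at_right 0. \<epsilon> \<in> {0<..<x}"
      by (rule eventually_at_right_real[OF \<open>x > 0\<close>])
    thus "\<forall>\<^sub>F \<epsilon> in at_right 0. W (of_real (x - \<epsilon>)) - W (of_real (x + \<epsilon>)) + V =
        integral {0..x - \<epsilon>} ?K + (V + A - W (of_real (x + \<epsilon>)))"
    proof eventually_elim
      case (elim \<epsilon>)
      thus ?case by (subst left) auto
    qed
  qed
  show ?thesis
    unfolding has_osc_hilbert_def V_def [symmetric]
  proof (intro exI[of _ "\<lambda>\<epsilon>. V + A - W (of_real (x + \<epsilon>))"] conjI allI impI)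
    fix \<epsilon> assume \<epsilon>: "0 < \<epsilon> \<and> \<epsilon> < x"
    show "?K integrable_on {0..x - \<epsilon>}"
      by (rule osc_kernel_integrable[OF int]) (use \<epsilon> in auto)
    show "has_improper_integral ?K (x + \<epsilon>) (V + A - W (of_real (x + \<epsilon>)))"
      using right \<epsilon> by auto
  next
    show "((\<lambda>\<epsilon>. integral {0..x - \<epsilon>} ?K + (V + A - W (of_real (x + \<epsilon>)))) \<longlongrightarrow>
       \<i> * of_real pi * exp (\<i> * of_real (\<omega> * x)) * of_real (f x) + V) (at_right 0)"
      using lim by (simp only: Ff[OF \<open>x > 0\<close>])
  qed
qed

lemma has_osc_hilbert_unique:
  assumes "x > 0" "has_osc_hilbert f \<omega> x L" "has_osc_hilbert f \<omega> x L'"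
  shows "L = L'"
proof -
  obtain J where J: "\<And>\<epsilon>. 0 < \<epsilon> \<Longrightarrow> \<epsilon> < x \<Longrightarrow> has_improper_integral (osc_kernel f \<omega> x) (x + \<epsilon>) (J \<epsilon>)"
    "((\<lambda>\<epsilon>. integral {0..x - \<epsilon>} (osc_kernel f \<omega> x) + J \<epsilon>) \<longlongrightarrow> L) (at_right 0)"
    using assms(2) unfolding has_osc_hilbert_def by blast
  obtain J' where J': "\<And>\<epsilon>. 0 < \<epsilon> \<Longrightarrow> \<epsilon> < x \<Longrightarrow> has_improper_integral (osc_kernel f \<omega> x) (x + \<epsilon>) (J' \<epsilon>)"
    "((\<lambda>\<epsilon>. integral {0..x - \<epsilon>} (osc_kernel f \<omega> x) + J' \<epsilon>) \<longlongrightarrow> L') (at_right 0)"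
    using assms(3) unfolding has_osc_hilbert_def by blast
  have "J \<epsilon> = J' \<epsilon>" if "0 < \<epsilon>" "\<epsilon> < x" for \<epsilon>
    using J(1)[OF that] J'(1)[OF that] tendsto_unique[OF trivial_limit_at_top_linorder]
    unfolding has_improper_integral_def by blast
  moreover have "\<forall>\<^sub>F \<epsilon> in at_right 0. 0 < \<epsilon> \<and> \<epsilon> < x"
    using \<open>x > 0\<close> eventually_at_right_real by force
  ultimately have "\<forall>\<^sub>F \<epsilon> in at_right 0. integral {0..x - \<epsilon>} (osc_kernel f \<omega> x) + J \<epsilon> =
      integral {0..x - \<epsilon>} (osc_kernel f \<omega> x) + J' \<epsilon>"
    by (auto elim: eventually_mono)
  from Lim_transform_eventually[OF J(2) this] J'(2) show ?thesis
    using tendsto_unique[OF trivial_limit_at_right_real] by blast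
qed

section \<open>The Laplace integral on the imaginary axis\<close>

lemma filterlim_imaginary_axis_quadrant:
  "filterlim (\<lambda>y. \<i> * complex_of_real y) (at 0 within first_quadrant) (at_right 0)"
  unfolding filterlim_at
  using eventually_at_right_less[of "0::real"]
  by (auto simp: first_quadrant_def intro!: tendsto_eq_intros elim!: eventually_mono)

lemma bounded_ratio_half_line:
  fixes g :: "real \<Rightarrow> complex" and k :: "real \<Rightarrow> real"
  assumes "continuous_on {0<..} g" "continuous_on {0<..} k" "\<And>y. y > 0 \<Longrightarrow> k y > 0"
    and "g \<in> O[at_right 0](\<lambda>y. of_real (k y))" "g \<in> O[at_top](\<lambda>y. of_real (k y))"
  obtains C where "C \<ge> 0" "\<And>y. y > 0 \<Longrightarrow> norm (g y) \<le> C * k y"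
proof -
  obtain c1 where "c1 > 0" and "\<forall>\<^sub>F y in at_right 0. norm (g y) \<le> c1 * norm (complex_of_real (k y))"
    using assms(4) by (elim landau_o.bigE)
  then obtain u where "u > 0" and u: "\<And>y. y > 0 \<Longrightarrow> y < u \<Longrightarrow> norm (g y) \<le> c1 * k y"
    using assms(3) by (force simp: eventually_at_right)
  obtain c2 where "c2 > 0" and "\<forall>\<^sub>F y in at_top. norm (g y) \<le> c2 * norm (complex_of_real (k y))"
    using assms(5) by (elim landau_o.bigE)
  then obtain v where v: "\<And>y. y \<ge> v \<Longrightarrow> y > 0 \<Longrightarrow> norm (g y) \<le> c2 * k y"
    using assms(3) by (force simp: eventually_at_top_linorder)
  have "k y \<noteq> 0" if "y \<in> {u..v}" for y
    using assms(3)[of y] that \<open>u > 0\<close> by auto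
  hence "continuous_on {u..v} (\<lambda>y. g y / of_real (k y))"
    using \<open>u > 0\<close>
    by (intro continuous_intros continuous_on_subset[OF assms(1)] continuous_on_subset[OF assms(2)]) auto
  hence "bounded ((\<lambda>y. g y / of_real (k y)) ` {u..v})"
    by (intro compact_imp_bounded compact_continuous_image) auto
  then obtain c3 where "c3 > 0" and c3: "\<And>y. u \<le> y \<Longrightarrow> y \<le> v \<Longrightarrow> norm (g y / of_real (k y)) \<le> c3"
    unfolding bounded_pos by force
  show ?thesis
  proof (rule that[of "c1 + c2 + c3"])
    fix y :: real assume y: "y > 0"
    note ky = assms(3)[OF y]
    have "norm (g y) \<le> c1 * k y \<or> norm (g y) \<le> c2 * k y \<or> norm (g y) \<le> c3 * k y"
      using u[OF y] v[of y] y c3[of y] ky by (cases "y < u"; cases "y \<ge> v") (auto simp: norm_divide field_simps)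
    moreover have "c1 * k y > 0" "c2 * k y > 0" "c3 * k y > 0"
      using ky \<open>c1 > 0\<close> \<open>c2 > 0\<close> \<open>c3 > 0\<close> by auto
    ultimately show "norm (g y) \<le> (c1 + c2 + c3) * k y"
      by (auto simp: distrib_right)
  qed (use \<open>c1 > 0\<close> \<open>c2 > 0\<close> \<open>c3 > 0\<close> in auto)
qed

lemma powr_exp_bigo:
  assumes "c > 0"
  shows "(\<lambda>y::real. y powr e) \<in> O[at_top](\<lambda>y. exp (c * y))"
  using assms by real_asymp

lemma powr_exp_bigo_exp:
  assumes "d < D"
  shows "(\<lambda>y::real. y powr e * exp (d * y)) \<in> O[at_top](\<lambda>y. y powr e' * exp (D * y))"
proof -
  have "(\<lambda>y::real. y powr e' * exp (d * y) * y powr (e - e')) \<in> O[at_top](\<lambda>y. y powr e' * exp (d * y) * exp ((D - d) * y))"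
    by (intro landau_o.big.mult landau_o.big_refl powr_exp_bigo) (use assms in auto)
  also have "(\<lambda>y::real. y powr e' * exp (d * y) * y powr (e - e')) = (\<lambda>y. y powr e * exp (d * y))"
    by (auto simp: fun_eq_iff powr_diff)
  also have "(\<lambda>y::real. y powr e' * exp (d * y) * exp ((D - d) * y)) = (\<lambda>y. y powr e' * exp (D * y))"
    by (auto simp: fun_eq_iff mult.assoc algebra_simps simp flip: exp_add)
  finally show ?thesis .
qed

text \<open>
  The remainder of the expansion is controlled by one function on the whole half-line, so that its
  Laplace transform is bounded by a single Gamma integral and no splitting of the integral is
  needed. The exponential rate must exceed \<open>d\<close> in order to absorb the powers of \<open>y\<close> at infinity.
\<close>
lemma imaginary_axis_bound:
  fixes F :: "complex \<Rightarrow> complex" and a :: "nat \<Rightarrow> real" and \<alpha> \<delta> d D x M :: real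
  assumes "x > 0" and hol: "F analytic_on first_quadrant"
    and growth: "\<forall>z\<in>first_quadrant. norm z \<ge> R \<longrightarrow>
           norm (F z) \<le> M * norm z powr \<delta> * exp (d * Im z)"
    and "0 \<le> d" "d < D"
    and expansion: "(\<lambda>z. F z - (\<Sum>j<N. of_real (a j) * z powr of_real (real j - \<alpha>)))
           \<in> O[at 0 within first_quadrant](\<lambda>z. z powr of_real (real N - \<alpha>))"
  obtains C where "C \<ge> 0"
    "\<And>y. y > 0 \<Longrightarrow> norm (F (\<i> * of_real y) / (\<i> * of_real y - of_real x) +
        (\<Sum>l<N. of_real (kernel_coeff a x l) * (\<i> * of_real y) powr of_real (real l - \<alpha>)))
       \<le> C * (y powr (real N - \<alpha>) * exp (D * y))"
proof -
  define g where "g = (\<lambda>y. F (\<i> * of_real y) / (\<i> * of_real y - of_real x) +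
        (\<Sum>l<N. of_real (kernel_coeff a x l) * (\<i> * of_real y) powr of_real (real l - \<alpha>)))"
  define k where "k = (\<lambda>y. y powr (real N - \<alpha>) * exp (D * y))"
  have nz: "\<i> * of_real y - of_real x \<noteq> 0" for y
    using \<open>x > 0\<close> by (auto simp: complex_eq_iff)
  have cF: "continuous_on first_quadrant F"
    using hol by (intro holomorphic_on_imp_continuous_on analytic_imp_holomorphic)
  have "continuous_on {0<..} (\<lambda>y. F (\<i> * of_real y))"
    by (rule continuous_on_compose2[OF cF]) (auto intro!: continuous_intros simp: first_quadrant_def)
  hence "continuous_on {0<..} g"
    unfolding g_def using nz by (intro continuous_intros) (auto simp: complex_nonpos_Reals_iff)
  moreover have "continuous_on {0<..} k"
    unfolding k_def by (intro continuous_intros) auto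
  moreover have "k y > 0" if "y > 0" for y
    using that by (simp add: k_def)
  moreover have "g \<in> O[at_right 0](\<lambda>y. of_real (k y))"
  proof -
    have "g \<in> O[at_right 0](\<lambda>y. (\<i> * of_real y) powr of_real (real N - \<alpha>))"
      unfolding g_def
      by (rule landau_o.big.compose[OF quadrant_kernel_expansion[OF \<open>x > 0\<close> expansion] filterlim_imaginary_axis_quadrant])
    also have "(\<lambda>y. (\<i> * of_real y) powr of_real (real N - \<alpha>)) \<in> O[at_right 0](\<lambda>y. of_real (k y))"
    proof (rule bigoI[where c = 1])
      show "\<forall>\<^sub>F y in at_right 0. norm ((\<i> * of_real y) powr of_real (real N - \<alpha>)) \<le> 1 * norm (complex_of_real (k y))"
        using eventually_at_right_less[of "0::real"]
      proof eventually_elim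
        case (elim y)
        have "norm ((\<i> * of_real y) powr of_real (real N - \<alpha>)) = y powr (real N - \<alpha>) * 1"
          using elim by (subst norm_powr_real_powr') (auto simp: norm_mult)
        also have "\<dots> \<le> y powr (real N - \<alpha>) * exp (D * y)"
          using elim assms by (intro mult_left_mono) auto
        finally show ?case
          by (simp only: k_def norm_of_real abs_mult) simp
      qed
    qed
    finally show ?thesis .
  qed
  moreover have "g \<in> O[at_top](\<lambda>y. of_real (k y))"
  proof -
    have "(\<lambda>y. F (\<i> * of_real y) / (\<i> * of_real y - of_real x)) \<in> O[at_top](\<lambda>y. of_real (y powr (\<delta> - 1) * exp (d * y)))"
    proof (rule bigoI[where c = M])
      show "\<forall>\<^sub>F y in at_top. norm (F (\<i> * of_real y) / (\<i> * of_real y - of_real x)) \<le> M * norm (complex_of_real (y powr (\<delta> - 1) * exp (d * y)))"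
        using eventually_gt_at_top[of 0] eventually_ge_at_top[of R]
      proof eventually_elim
        case (elim y)
        have "norm (F (\<i> * of_real y)) \<le> M * y powr \<delta> * exp (d * y)"
          using growth[rule_format, of "\<i> * of_real y"] elim by (simp add: first_quadrant_def norm_mult)
        moreover have "y \<le> norm (\<i> * of_real y - complex_of_real x)"
          using abs_Im_le_cmod[of "\<i> * of_real y - of_real x"] elim by simp
        ultimately have "norm (F (\<i> * of_real y) / (\<i> * of_real y - of_real x)) \<le> (M * y powr \<delta> * exp (d * y)) / y"
          unfolding norm_divide using elim by (intro frac_le) (auto intro: order_trans[OF norm_ge_zero])
        also have "\<dots> = M * norm (complex_of_real (y powr (\<delta> - 1) * exp (d * y)))"
          using elim by (simp only: norm_of_real abs_mult powr_diff) simp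
        finally show ?case .
      qed
    qed
    also have "(\<lambda>y. complex_of_real (y powr (\<delta> - 1) * exp (d * y))) \<in> O[at_top](\<lambda>y. of_real (k y))"
      unfolding landau_o.big.of_real_iff k_def by (rule powr_exp_bigo_exp[OF \<open>d < D\<close>])
    finally have 1: "(\<lambda>y. F (\<i> * of_real y) / (\<i> * of_real y - of_real x)) \<in> O[at_top](\<lambda>y. of_real (k y))" .
    have 2: "(\<lambda>y. (\<i> * of_real y) powr of_real (real l - \<alpha>)) \<in> O[at_top](\<lambda>y. of_real (k y))" for l
    proof -
      have "(\<lambda>y. (\<i> * of_real y) powr of_real (real l - \<alpha>)) \<in> O[at_top](\<lambda>y. complex_of_real (y powr (real l - \<alpha>) * exp (0 * y)))"
      proof (rule bigoI[where c = 1])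
        show "\<forall>\<^sub>F y in at_top. norm ((\<i> * of_real y) powr of_real (real l - \<alpha>)) \<le> 1 * norm (complex_of_real (y powr (real l - \<alpha>) * exp (0 * y)))"
          using eventually_gt_at_top[of 0]
          by eventually_elim (subst norm_powr_real_powr', auto simp: norm_mult)
      qed
      also have "(\<lambda>y. complex_of_real (y powr (real l - \<alpha>) * exp (0 * y))) \<in> O[at_top](\<lambda>y. of_real (k y))"
        unfolding landau_o.big.of_real_iff k_def by (rule powr_exp_bigo_exp) (use assms in auto)
      finally show ?thesis .
    qed
    have 3: "(\<lambda>y. of_real (kernel_coeff a x l) * (\<i> * of_real y) powr of_real (real l - \<alpha>)) \<in> O[at_top](\<lambda>y. of_real (k y))" for l
      using 2[of l] by (cases "kernel_coeff a x l = 0") auto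
    show ?thesis
      unfolding g_def by (intro sum_in_bigo(1) 1 big_sum_in_bigo 3)
  qed
  ultimately obtain C where "C \<ge> 0" "\<And>y. y > 0 \<Longrightarrow> norm (g y) \<le> C * k y"
    using bounded_ratio_half_line[of g k] by blast
  thus ?thesis
    by (intro that[of C]) (auto simp: g_def k_def)
qed

text \<open>
  The substitution \<open>y \<mapsto> \<omega> * y\<close> in Euler's integral.
\<close>
lemma laplace_powr:
  fixes s \<omega> :: real
  assumes "s > 0" "\<omega> > 0"
  shows "(\<lambda>y. y powr (s - 1) * exp (- \<omega> * y)) absolutely_integrable_on {0<..}"
    and "((\<lambda>y. y powr (s - 1) * exp (- \<omega> * y)) has_integral Gamma s / \<omega> powr s) {0<..}"
proof -
  let ?g = "\<lambda>y::real. y powr (s - 1) / exp y"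
  have hi: "(?g has_integral Gamma s) {0<..}"
    using Gamma_integral_real[OF assms(1)]
    by (rule has_integral_spike_set_eq[THEN iffD1, rotated 2]) (auto intro: negligible_subset[of "{0}"])
  have ai: "?g absolutely_integrable_on {0<..}"
    using hi by (intro nonnegative_absolutely_integrable_1) (auto simp: has_integral_integrable)
  have im: "(\<lambda>y. \<omega> * y) ` {0<..} = {0<..}"
  proof (intro equalityI subsetI)
    fix y :: real assume "y \<in> {0<..}"
    thus "y \<in> (\<lambda>y. \<omega> * y) ` {0<..}"
      using assms by (intro image_eqI[of _ _ "y / \<omega>"]) auto
  qed (use assms in auto)
  have "(\<lambda>y. \<bar>\<omega>\<bar> * ?g (\<omega> * y)) absolutely_integrable_on {0<..} \<and>
        integral {0<..} (\<lambda>y. \<bar>\<omega>\<bar> * ?g (\<omega> * y)) = Gamma s"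
    by (subst has_absolute_integral_change_of_variables_1')
       (use ai hi assms in \<open>auto simp: im inj_on_def integral_unique intro!: derivative_eq_intros\<close>)
  hence h: "(\<lambda>y. \<bar>\<omega>\<bar> * ?g (\<omega> * y)) absolutely_integrable_on {0<..}"
     "((\<lambda>y. \<bar>\<omega>\<bar> * ?g (\<omega> * y)) has_integral Gamma s) {0<..}"
    by (auto simp: has_integral_iff set_lebesgue_integral_eq_integral)
  have eq: "inverse (\<omega> powr s) * (\<bar>\<omega>\<bar> * ?g (\<omega> * y)) = y powr (s - 1) * exp (- \<omega> * y)" if "y \<in> {0<..}" for y
    using that assms by (simp add: powr_mult powr_diff exp_minus field_simps)
  show "(\<lambda>y. y powr (s - 1) * exp (- \<omega> * y)) absolutely_integrable_on {0<..}"
    using set_integrable_mult_right[OF h(1), of "inverse (\<omega> powr s)"] eq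
    by (subst set_integrable_cong[OF refl refl eq [symmetric]]) auto
  show "((\<lambda>y. y powr (s - 1) * exp (- \<omega> * y)) has_integral Gamma s / \<omega> powr s) {0<..}"
    using has_integral_mult_right[OF h(2), of "inverse (\<omega> powr s)"] eq
    by (subst has_integral_cong[OF eq [symmetric]]) (auto simp: divide_inverse mult.commute)
qed

lemma cauchy_kernel_imaginary:
  "cauchy_kernel F \<omega> x (\<i> * of_real y) =
     of_real (exp (- \<omega> * y)) * (F (\<i> * of_real y) / (\<i> * of_real y - of_real x))"
proof -
  have "\<i> * of_real \<omega> * (\<i> * of_real y) = of_real (- \<omega> * y)"
    by (simp add: mult_ac)
  thus ?thesis
    by (simp only: cauchy_kernel_def exp_of_real times_divide_eq_right)
qed

lemma rotated_integrand_absolutely_integrable: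
  assumes "x > 0" and hol: "F analytic_on first_quadrant" and "\<alpha> < 1" "D < \<omega>"
    and bnd: "\<And>y. y > 0 \<Longrightarrow> norm (F (\<i> * of_real y) / (\<i> * of_real y - of_real x)) \<le> C * (y powr (- \<alpha>) * exp (D * y))"
  shows "(\<lambda>y. \<i> * cauchy_kernel F \<omega> x (\<i> * of_real y)) absolutely_integrable_on {0<..}"
proof (rule measurable_bounded_by_integrable_imp_absolutely_integrable)
  have cF: "continuous_on first_quadrant F"
    using hol by (intro holomorphic_on_imp_continuous_on analytic_imp_holomorphic)
  have "continuous_on {0<..} (\<lambda>y. F (\<i> * of_real y))"
    by (rule continuous_on_compose2[OF cF]) (auto intro!: continuous_intros simp: first_quadrant_def)
  moreover have "\<i> * of_real y - of_real x \<noteq> 0" for y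
    using \<open>x > 0\<close> by (auto simp: complex_eq_iff)
  ultimately have "continuous_on {0<..} (\<lambda>y. \<i> * cauchy_kernel F \<omega> x (\<i> * of_real y))"
    unfolding cauchy_kernel_def by (intro continuous_intros) auto
  thus "(\<lambda>y. \<i> * cauchy_kernel F \<omega> x (\<i> * of_real y)) \<in> borel_measurable (lebesgue_on {0<..})"
    by (rule continuous_imp_measurable_on_sets_lebesgue) auto
  have "(\<lambda>y. y powr ((1 - \<alpha>) - 1) * exp (- (\<omega> - D) * y)) integrable_on {0<..}"
    by (rule has_integral_integrable[OF laplace_powr(2)]) (use assms in auto)
  thus "(\<lambda>y. C * (y powr (- \<alpha>) * exp (- (\<omega> - D) * y))) integrable_on {0<..}"
    by (intro integrable_on_mult_right) simp
  fix y :: real assume "y \<in> {0<..}"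
  hence "norm (\<i> * cauchy_kernel F \<omega> x (\<i> * of_real y)) \<le> exp (- \<omega> * y) * (C * (y powr (- \<alpha>) * exp (D * y)))"
    unfolding cauchy_kernel_imaginary norm_mult using bnd[of y] by (simp add: norm_mult)
  also have "\<dots> = C * (y powr (- \<alpha>) * (exp (- \<omega> * y) * exp (D * y)))"
    by (simp only: mult_ac)
  also have "exp (- \<omega> * y) * exp (D * y) = exp (- (\<omega> - D) * y)"
    by (simp add: algebra_simps flip: exp_add)
  finally show "norm (\<i> * cauchy_kernel F \<omega> x (\<i> * of_real y)) \<le> C * (y powr (- \<alpha>) * exp (- (\<omega> - D) * y))" .
qed auto

text \<open>
  The phase of the expansion: \<open>\<i> powr s\<close> comes from the value on the imaginary axis and the other
  factor \<open>\<i>\<close> from \<open>dz = \<i> dy\<close>.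
\<close>
lemma i_times_powr_i:
  assumes "y > 0"
  shows "\<i> * (\<i> * of_real y) powr of_real s =
         exp (of_real (pi / 2 * (s + 1)) * \<i>) * of_real (y powr s)"
proof -
  have "(\<i> * of_real y) powr of_real s = \<i> powr of_real s * of_real (y powr s)"
    using powr_times_real_left[of "of_real y" \<i> "of_real s"] powr_of_real[of y s] assms
    by (simp add: mult.commute)
  moreover have "\<i> * \<i> powr of_real s = exp (\<i> * of_real pi / 2) * exp (of_real s * (\<i> * of_real pi / 2))"
    using cis_conv_exp[of "pi / 2"] by (simp add: powr_def)
  moreover have "exp (\<i> * of_real pi / 2) * exp (of_real s * (\<i> * of_real pi / 2)) =
      exp (of_real (pi / 2 * (s + 1)) * \<i>)"
    unfolding exp_add [symmetric] by (rule arg_cong[of _ _ exp]) (simp add: field_simps)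
  ultimately show ?thesis
    by (metis mult.assoc)
qed

text \<open>
  Watson's lemma: adding the expansion of the integrand removes all terms below order \<open>N\<close>, each of
  which integrates to a Gamma value, and the bound on the rest integrates to another one.
\<close>
lemma rotated_integral_expansion:
  assumes "D < \<omega>" "0 < \<omega>" "\<alpha> < 1"
    and int: "(\<lambda>y. \<i> * cauchy_kernel F \<omega> x (\<i> * of_real y)) integrable_on {0<..}"
    and bnd: "\<And>y. y > 0 \<Longrightarrow> norm (F (\<i> * of_real y) / (\<i> * of_real y - of_real x) +
        (\<Sum>l<N. of_real (c l) * (\<i> * of_real y) powr of_real (real l - \<alpha>)))
       \<le> C * (y powr (real N - \<alpha>) * exp (D * y))"
  shows "norm (integral {0<..} (\<lambda>y. \<i> * cauchy_kernel F \<omega> x (\<i> * of_real y)) +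
      (\<Sum>l<N. of_real (Gamma (real l + 1 - \<alpha>) / \<omega> powr (real l + 1 - \<alpha>)) *
           exp (of_real (pi / 2 * (real l + 1 - \<alpha>)) * \<i>) * of_real (c l)))
    \<le> C * (Gamma (real N + 1 - \<alpha>) / (\<omega> - D) powr (real N + 1 - \<alpha>))"
proof -
  let ?t = "\<lambda>y. \<i> * cauchy_kernel F \<omega> x (\<i> * of_real y)"
  let ?E = "\<lambda>l. exp (of_real (pi / 2 * (real l + 1 - \<alpha>)) * \<i>)"
  let ?m = "\<lambda>y. \<Sum>l<N. of_real (y powr (real l + 1 - \<alpha> - 1) * exp (- \<omega> * y)) * ?E l * of_real (c l)"
  let ?M = "\<Sum>l<N. of_real (Gamma (real l + 1 - \<alpha>) / \<omega> powr (real l + 1 - \<alpha>)) * ?E l * of_real (c l)"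
  have "(?m has_integral ?M) {0<..}"
  proof (intro has_integral_sum has_integral_mult_left)
    fix l assume "l \<in> {..<N}"
    have "((\<lambda>y. y powr (real l + 1 - \<alpha> - 1) * exp (- \<omega> * y)) has_integral
        Gamma (real l + 1 - \<alpha>) / \<omega> powr (real l + 1 - \<alpha>)) {0<..}"
      by (rule laplace_powr(2)) (use assms in auto)
    from has_integral_linear[OF this bounded_linear_of_real]
    show "((\<lambda>y. complex_of_real (y powr (real l + 1 - \<alpha> - 1) * exp (- \<omega> * y))) has_integral
        of_real (Gamma (real l + 1 - \<alpha>) / \<omega> powr (real l + 1 - \<alpha>))) {0<..}"
      unfolding o_def .
  qed auto
  hence sum: "((\<lambda>y. ?t y + ?m y) has_integral (integral {0<..} ?t + ?M)) {0<..}"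
    by (intro has_integral_add integrable_integral int)
  have "((\<lambda>y. y powr (real N + 1 - \<alpha> - 1) * exp (- (\<omega> - D) * y)) has_integral
        Gamma (real N + 1 - \<alpha>) / (\<omega> - D) powr (real N + 1 - \<alpha>)) {0<..}"
    by (rule laplace_powr(2)) (use assms in auto)
  hence dom: "((\<lambda>y. C * (y powr (real N + 1 - \<alpha> - 1) * exp (- (\<omega> - D) * y))) has_integral
        C * (Gamma (real N + 1 - \<alpha>) / (\<omega> - D) powr (real N + 1 - \<alpha>))) {0<..}"
    by (rule has_integral_mult_right)
  have "norm (integral {0<..} (\<lambda>y. ?t y + ?m y)) \<le>
        integral {0<..} (\<lambda>y. C * (y powr (real N + 1 - \<alpha> - 1) * exp (- (\<omega> - D) * y)))"
  proof (rule integral_norm_bound_integral)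
    fix y :: real assume "y \<in> {0<..}"
    hence y: "y > 0" by simp
    have m: "?m y = of_real (exp (- \<omega> * y)) * (\<i> * (\<Sum>l<N. of_real (c l) * (\<i> * of_real y) powr of_real (real l - \<alpha>)))"
      unfolding sum_distrib_left
    proof (rule sum.cong)
      fix l assume "l \<in> {..<N}"
      have "\<i> * (of_real (c l) * (\<i> * of_real y) powr of_real (real l - \<alpha>)) =
            of_real (c l) * (\<i> * (\<i> * of_real y) powr of_real (real l - \<alpha>))"
        by (simp only: mult_ac)
      also have "\<i> * (\<i> * of_real y) powr of_real (real l - \<alpha>) =
            exp (of_real (pi / 2 * (real l - \<alpha> + 1)) * \<i>) * of_real (y powr (real l - \<alpha>))"
        by (rule i_times_powr_i[OF y])
      finally have rotated: "\<i> * (of_real (c l) * (\<i> * of_real y) powr of_real (real l - \<alpha>)) =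
            of_real (c l) * (exp (of_real (pi / 2 * (real l - \<alpha> + 1)) * \<i>) * of_real (y powr (real l - \<alpha>)))" .
      have e: "real l + 1 - \<alpha> = real l - \<alpha> + 1" "real l - \<alpha> + 1 - 1 = real l - \<alpha>"
        by simp_all
      show "of_real (y powr (real l + 1 - \<alpha> - 1) * exp (- \<omega> * y)) * ?E l * of_real (c l) =
         of_real (exp (- \<omega> * y)) * (\<i> * (of_real (c l) * (\<i> * of_real y) powr of_real (real l - \<alpha>)))"
        unfolding rotated e by (simp only: of_real_mult mult_ac)
    qed auto
    have "?t y + ?m y = of_real (exp (- \<omega> * y)) * (\<i> * (F (\<i> * of_real y) / (\<i> * of_real y - of_real x) +
        (\<Sum>l<N. of_real (c l) * (\<i> * of_real y) powr of_real (real l - \<alpha>))))"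
      unfolding m cauchy_kernel_imaginary distrib_left by (simp only: mult_ac)
    hence "norm (?t y + ?m y) = exp (- \<omega> * y) * norm (F (\<i> * of_real y) / (\<i> * of_real y - of_real x) +
        (\<Sum>l<N. of_real (c l) * (\<i> * of_real y) powr of_real (real l - \<alpha>)))"
      by (simp only: norm_mult norm_ii norm_of_real abs_exp_cancel mult_1_left)
    also have "\<dots> \<le> exp (- \<omega> * y) * (C * (y powr (real N - \<alpha>) * exp (D * y)))"
      by (intro mult_left_mono bnd y) auto
    also have "\<dots> = C * (y powr (real N - \<alpha>) * (exp (- \<omega> * y) * exp (D * y)))"
      by (simp only: mult_ac)
    also have "exp (- \<omega> * y) * exp (D * y) = exp (- (\<omega> - D) * y)"
      by (simp add: algebra_simps flip: exp_add)
    finally show "norm (?t y + ?m y) \<le> C * (y powr (real N + 1 - \<alpha> - 1) * exp (- (\<omega> - D) * y))"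
      by simp
  qed (use sum dom in \<open>auto intro: has_integral_integrable\<close>)
  thus ?thesis
    unfolding integral_unique[OF sum] integral_unique[OF dom] .
qed

section \<open>The asymptotic expansion\<close>

theorem theorem2p2:
  fixes f :: "real \<Rightarrow> real" and F :: "complex \<Rightarrow> complex"
    and a :: "nat \<Rightarrow> real" and \<alpha> M \<delta> d :: real
  assumes "\<And>b. f absolutely_integrable_on {0..b}"
    and "f C1_differentiable_on {0<..}"
    and "F analytic_on first_quadrant"
    and "\<And>t. t > 0 \<Longrightarrow> F (of_real t) = of_real (f t)"
    and "algebraic_at_origin F"
    and "M > 0" and "\<delta> < 1" and "d \<ge> 0"
    and "\<exists>R. \<forall>z\<in>first_quadrant. norm z \<ge> R \<longrightarrow>
           norm (F z) \<le> M * norm z powr \<delta> * exp (d * Im z)"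
    and "0 \<le> \<alpha>" and "\<alpha> < 1"
    and "\<And>N. (\<lambda>t. f t - (\<Sum>j<N. a j * t powr (real j - \<alpha>)))
                 \<in> O[at_right 0](\<lambda>t. t powr (real N - \<alpha>))"
  shows "\<forall>x>0.
    (\<forall>\<omega>>d. \<exists>L. has_osc_hilbert f \<omega> x L) \<and>
    (\<forall>N. (\<lambda>\<omega>. osc_hilbert f \<omega> x -
            (\<i> * of_real pi * exp (\<i> * of_real (\<omega> * x)) * of_real (f x) -
             (\<Sum>l<N. of_real (Gamma (real l + 1 - \<alpha>) / \<omega> powr (real l + 1 - \<alpha>)) *
                exp (of_real (pi / 2 * (real l + 1 - \<alpha>)) * \<i>) *
                of_real (\<Sum>(j, k)\<in>{(j, k). j + k = l}. a j / x ^ (k + 1)))))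
          \<in> O[at_top](\<lambda>\<omega>. of_real (\<omega> powr (- (real N + 1 - \<alpha>)))))"
proof (intro allI impI)
  fix x :: real assume "x > 0"
  note int = assms(1) and hol = assms(3) and Ff = assms(4)
  obtain R where growth: "\<forall>z\<in>first_quadrant. norm z \<ge> R \<longrightarrow>
           norm (F z) \<le> M * norm z powr \<delta> * exp (d * Im z)"
    using assms(9) by blast
  note expansion = quadrant_expansion[OF assms(5) Ff assms(12)]
  have orig: "(\<lambda>z. F z / (z - of_real x)) \<in> O[at 0 within first_quadrant](\<lambda>z. z powr of_real (- \<alpha>))"
    using quadrant_kernel_expansion[OF \<open>x > 0\<close> expansion[where N = 0]] by simp
  define V where "V = (\<lambda>\<omega>. integral {0<..} (\<lambda>y. \<i> * cauchy_kernel F \<omega> x (\<i> * of_real y)))"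
  have ray: "(\<lambda>y. \<i> * cauchy_kernel F \<omega> x (\<i> * of_real y)) absolutely_integrable_on {0<..}" if "\<omega> > d" for \<omega>
  proof -
    \<comment> \<open>room between \<open>d\<close> and \<open>\<omega>\<close>: the estimate on the axis loses an arbitrarily small rate\<close>
    from dense[OF that] obtain D where D: "d < D" "D < \<omega>" by blast
    obtain C where "\<And>y. y > 0 \<Longrightarrow> norm (F (\<i> * of_real y) / (\<i> * of_real y - of_real x)) \<le> C * (y powr (- \<alpha>) * exp (D * y))"
      using imaginary_axis_bound[OF \<open>x > 0\<close> hol growth assms(8) D(1) expansion[where N = 0]] by auto
    thus ?thesis
      by (rule rotated_integrand_absolutely_integrable[OF \<open>x > 0\<close> hol assms(11) D(2)])
  qed
  have H: "has_osc_hilbert f \<omega> x (\<i> * of_real pi * exp (\<i> * of_real (\<omega> * x)) * of_real (f x) + V \<omega>)" if "\<omega> > d" for \<omega>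
    unfolding V_def
    by (rule has_osc_hilbert_rotated[OF \<open>x > 0\<close> _ int hol Ff assms(6,7) that growth assms(10,11) orig ray[OF that]])
       (use that assms(8) in auto)
  have H_eq: "osc_hilbert f \<omega> x = \<i> * of_real pi * exp (\<i> * of_real (\<omega> * x)) * of_real (f x) + V \<omega>" if "\<omega> > d" for \<omega>
    unfolding osc_hilbert_def
    by (rule the_equality) (use H[OF that] has_osc_hilbert_unique[OF \<open>x > 0\<close>] in blast)+
  show "(\<forall>\<omega>>d. \<exists>L. has_osc_hilbert f \<omega> x L) \<and>
    (\<forall>N. (\<lambda>\<omega>. osc_hilbert f \<omega> x -
            (\<i> * of_real pi * exp (\<i> * of_real (\<omega> * x)) * of_real (f x) -
             (\<Sum>l<N. of_real (Gamma (real l + 1 - \<alpha>) / \<omega> powr (real l + 1 - \<alpha>)) *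
                exp (of_real (pi / 2 * (real l + 1 - \<alpha>)) * \<i>) *
                of_real (\<Sum>(j, k)\<in>{(j, k). j + k = l}. a j / x ^ (k + 1)))))
          \<in> O[at_top](\<lambda>\<omega>. of_real (\<omega> powr (- (real N + 1 - \<alpha>)))))"
    unfolding kernel_coeff_def [symmetric]
  proof (intro conjI allI impI)
    show "\<exists>L. has_osc_hilbert f \<omega> x L" if "\<omega> > d" for \<omega>
      using H[OF that] by blast
  next
    fix N :: nat
    \<comment> \<open>any fixed rate above \<open>d\<close> serves; for \<open>\<omega> \<ge> 2 * D\<close> the shift by \<open>D\<close> costs a factor \<open>2 powr p\<close>\<close>
    define D where "D = d + 1"
    define p where "p = real N + 1 - \<alpha>"
    have D: "d < D" "D > 0" and p: "p > 0" using assms(8,11) by (auto simp: D_def p_def)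
    obtain C where "C \<ge> 0" and C: "\<And>y. y > 0 \<Longrightarrow> norm (F (\<i> * of_real y) / (\<i> * of_real y - of_real x) +
        (\<Sum>l<N. of_real (kernel_coeff a x l) * (\<i> * of_real y) powr of_real (real l - \<alpha>)))
       \<le> C * (y powr (real N - \<alpha>) * exp (D * y))"
      using imaginary_axis_bound[OF \<open>x > 0\<close> hol growth assms(8) D(1) expansion[where N = N]] by blast
    let ?S = "\<lambda>\<omega>. \<Sum>l<N. of_real (Gamma (real l + 1 - \<alpha>) / \<omega> powr (real l + 1 - \<alpha>)) *
                exp (of_real (pi / 2 * (real l + 1 - \<alpha>)) * \<i>) * of_real (kernel_coeff a x l)"
    show "(\<lambda>\<omega>. osc_hilbert f \<omega> x - (\<i> * of_real pi * exp (\<i> * of_real (\<omega> * x)) * of_real (f x) - ?S \<omega>))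
          \<in> O[at_top](\<lambda>\<omega>. of_real (\<omega> powr (- (real N + 1 - \<alpha>))))"
    proof (rule bigoI[where c = "C * Gamma p * 2 powr p"])
      show "\<forall>\<^sub>F \<omega> in at_top. norm (osc_hilbert f \<omega> x -
          (\<i> * of_real pi * exp (\<i> * of_real (\<omega> * x)) * of_real (f x) - ?S \<omega>))
        \<le> C * Gamma p * 2 powr p * norm (complex_of_real (\<omega> powr (- (real N + 1 - \<alpha>))))"
        using eventually_ge_at_top[of "2 * D"]
      proof eventually_elim
        case (elim \<omega>)
        have \<omega>: "\<omega> > d" "\<omega> > D" "\<omega> > 0" "\<omega> / 2 \<le> \<omega> - D" using elim D by auto
        have "osc_hilbert f \<omega> x - (\<i> * of_real pi * exp (\<i> * of_real (\<omega> * x)) * of_real (f x) - ?S \<omega>) = V \<omega> + ?S \<omega>"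
          unfolding H_eq[OF \<omega>(1)] by simp
        also have "norm \<dots> \<le> C * (Gamma p / (\<omega> - D) powr p)"
          unfolding V_def p_def
          by (rule rotated_integral_expansion[OF \<omega>(2,3) assms(11) set_lebesgue_integral_eq_integral(1)[OF ray[OF \<omega>(1)]] C])
        also have "\<dots> \<le> C * (Gamma p / (\<omega> / 2) powr p)"
          using \<omega> p \<open>C \<ge> 0\<close> Gamma_real_pos[OF p]
          by (intro mult_left_mono divide_left_mono powr_mono2 mult_pos_pos) auto
        also have "\<dots> = C * Gamma p * 2 powr p * norm (complex_of_real (\<omega> powr (- p)))"
          using \<omega> by (simp only: norm_of_real) (simp add: powr_divide powr_minus divide_simps)
        finally show ?case unfolding p_def .
      qed
    qed
  qed
qed

end
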